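(* Let $X\subset\mathbb{C}^d$ be compact and let $(T_i,w_i)_{i\in\mathcal I}$ be a $C^\omega$ map-weight system on $X$ such that $(T_i)_{i\in\mathcal I}$ is complex contracting. Then, for every admissible domain $D$ and every favourable space $A$ of holomorphic functions on $D$, the transfer operator $\mathcal L f=\sum_{i\in\mathcal I}w_i\cdot f\circ T_i$ satisfies $\mathcal L(A)\subset A$, and the eigenvalue sequence of $\mathcal L_A:=\mathcal L|_A:A\to A$ is precisely the Ruelle eigenvalue sequence; that is, $\lambda(\mathcal L_A)=\lambda(\mathcal L_{U(D_0)})$ for every admissible domain $D_0$.
   Context: A domain is a non-empty connected open set; $\mathcal D_d$ is the set of bounded domains in $\mathbb{C}^d$. For bounded sets, $\Delta_1\subset\subset\Delta_2$ means $\overline{\Delta_1}\subset\Delta_2$. For $D\in\mathcal D_d$ and a Banach space $B$, $U(D,B)$ is the Banach space of continuous functions $\overline D\to B$ that are holomorphic on $D$, with the supremum norm over $\overline D$; $U(D)=U(D,\mathbb{C})$. $L(\mathbb{C}^d)$ is the space of linear operators on $\mathbb{C}^d$ with the operator norm induced by the Euclidean norm. Let $\mathcal I$ be a non-empty countable set. A holomorphic map system on $D\in\mathcal D_d$ is a family $(T_i)_{i\in\mathcal I}$ with $T_i\in U(D,\mathbb{C}^d)$ and $\bigcup_{i}T_i(D)\subset\subset D$. A holomorphic weight system on $D$ is a family $(w_i)_{i\in\mathcal I}$ with $w_i\in U(D)$ and $\sum_{i}\|w_i\|_{U(D)}<\infty$. For $X\subset\mathbb{C}^d$ compact, a family of maps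 $T_i:X\to X$ (resp. $w_i:X\to\mathbb{C}$) is a $C^\omega$ map system (resp. $C^\omega$ weight system) on $X$ if there is $D\in\mathcal D_d$ with $X\subset\subset D$ such that the $T_i$ (resp. $w_i$) extend to $D$ and the extensions form a holomorphic map system (resp. holomorphic weight system) on $D$; any such $D$ is called admissible for it. A $C^\omega$ map-weight system is a pair consisting of a $C^\omega$ map system and a $C^\omega$ weight system on $X$ indexed by the same $\mathcal I$; a domain is admissible for it if it is admissible for both. The extensions are denoted by the same symbols; $X$ is non-empty, and the extensions of a given $T_i$ or $w_i$ to different domains containing $X$ are understood to agree on a neighbourhood of $X$. For $\underline i=(i_1,\ldots,i_n)\in\mathcal I^n$ put $T_{\underline i}=T_{i_n}\circ\cdots\circ T_{i_1}$. The map system $(T_i)_{i\in\mathcal I}$ is complex contracting if for some $n\in\mathbb{N}$ there exists $D\in\mathcal D_d$ with $X\subset\subset D$ such that $T_{\underline i}'\in U(D,L(\mathbb{C}^d))$ for every $\underline i\in\mathcal I^n$ and $\sup_{\underline i\in\mathcal I^n}\|T_{\underline i}'\|_{U(D,L(\mathbb{C}^d))}<1$. A favourable space of holomorphic functions on $D$ is a Banach space $A$ of holomorphic functions $f:D\to\mathbb{C}$ such that (i) for each $z\in D$ the point evaluation $f\mapsto f(z)$ is continuous on $A$; and (ii) $A$ contains $U(D)$, and the natural embedding $U(D)\hookrightarrow A$ has norm $1$. In particular $U(D)$ is favourable. On every favourable space the transfer operator is compact. For a compact operator $L$, its eigenvalue sequence $\lambda(L)=\{\lambda_n(L)\}_{n=1}^\infty$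 is the sequence of all (non-zero) eigenvalues counted with algebraic multiplicity and ordered by decreasing modulus (eigenvalues of equal modulus in any order), continued by zeros if there are only finitely many; equality of eigenvalue sequences is up to this freedom of ordering. The Ruelle eigenvalue sequence is the eigenvalue sequence of the transfer operator on $U(D_0)$, $D_0$ admissible. *)

theory Defs
  imports "HOL-Analysis.Analysis" "HOL-Library.Function_Algebras" "HOL-Library.Extended_Nat"
begin

definition bounded_domain :: "(complex ^ 'd) set \<Rightarrow> bool" where
  "bounded_domain D \<longleftrightarrow> D \<noteq> {} \<and> open D \<and> connected D \<and> bounded D"

definition compactly_inside :: "(complex ^ 'd) set \<Rightarrow> (complex ^ 'd) set \<Rightarrow> bool"
    (infix "\<subset>\<subset>" 50) where
  "S \<subset>\<subset> S' \<longleftrightarrow> closure S \<subseteq> S'"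

(* Complex Frechet differentiability.  There is no type class of complex normed spaces, so the
   complex scalar multiplication of the target space is an explicit argument. *)
definition holomorphic_map ::
    "(complex \<Rightarrow> 'b \<Rightarrow> 'b) \<Rightarrow> (complex ^ 'd \<Rightarrow> 'b::real_normed_vector) \<Rightarrow> (complex ^ 'd) set \<Rightarrow> bool" where
  "holomorphic_map scl f D \<longleftrightarrow>
     (\<forall>z\<in>D. \<exists>f'. (f has_derivative f') (at z) \<and> (\<forall>c v. f' (c *s v) = scl c (f' v)))"

(* Membership in U(D,B); the values of f outside the closure of D are irrelevant. *)
definition in_U ::
    "(complex \<Rightarrow> 'b \<Rightarrow> 'b) \<Rightarrow> (complex ^ 'd) set \<Rightarrow> (complex ^ 'd \<Rightarrow> 'b::real_normed_vector) \<Rightarrow> bool" where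
  "in_U scl D f \<longleftrightarrow> continuous_on (closure D) f \<and> holomorphic_map scl f D"

definition U_norm :: "(complex ^ 'd) set \<Rightarrow> (complex ^ 'd \<Rightarrow> 'b::real_normed_vector) \<Rightarrow> real" where
  "U_norm D f = (SUP z\<in>closure D. norm (f z))"

(* U(D) as a vector space: functions on the closure of D are represented by total functions
   vanishing elsewhere, so that equality of elements is equality of functions. *)
definition U_space :: "(complex ^ 'd) set \<Rightarrow> (complex ^ 'd \<Rightarrow> complex) set" where
  "U_space D = {f. in_U (*) D f \<and> (\<forall>z. z \<notin> closure D \<longrightarrow> f z = 0)}"

definition restrict_zero :: "'a set \<Rightarrow> ('a \<Rightarrow> complex) \<Rightarrow> 'a \<Rightarrow> complex" where
  "restrict_zero S f = (\<lambda>z. if z \<in> S then f z else 0)"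

definition holomorphic_map_system ::
    "(complex ^ 'd) set \<Rightarrow> 'i set \<Rightarrow> ('i \<Rightarrow> complex ^ 'd \<Rightarrow> complex ^ 'd) \<Rightarrow> bool" where
  "holomorphic_map_system D I T \<longleftrightarrow>
     (\<forall>i\<in>I. in_U (*s) D (T i)) \<and> (\<Union>i\<in>I. T i ` D) \<subset>\<subset> D"

definition holomorphic_weight_system ::
    "(complex ^ 'd) set \<Rightarrow> 'i set \<Rightarrow> ('i \<Rightarrow> complex ^ 'd \<Rightarrow> complex) \<Rightarrow> bool" where
  "holomorphic_weight_system D I w \<longleftrightarrow>
     (\<forall>i\<in>I. in_U (*) D (w i)) \<and> (\<lambda>i. U_norm D (w i)) summable_on I"

(* Since the extensions of a map or weight to different domains are to agree near X, a map or
   weight on X is given together with its germ along X: it is represented by a total function,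
   of which only the values on some neighbourhood of X matter. *)
definition agree_near :: "'a::topological_space set \<Rightarrow> ('a \<Rightarrow> 'b) \<Rightarrow> ('a \<Rightarrow> 'b) \<Rightarrow> bool" where
  "agree_near X f g \<longleftrightarrow> (\<exists>N. open N \<and> X \<subseteq> N \<and> (\<forall>z\<in>N. f z = g z))"

definition map_extension ::
    "(complex ^ 'd) set \<Rightarrow> 'i set \<Rightarrow> ('i \<Rightarrow> complex ^ 'd \<Rightarrow> complex ^ 'd) \<Rightarrow>
     (complex ^ 'd) set \<Rightarrow> ('i \<Rightarrow> complex ^ 'd \<Rightarrow> complex ^ 'd) \<Rightarrow> bool" where
  "map_extension X I T D T\<^sub>D \<longleftrightarrow>
     bounded_domain D \<and> X \<subset>\<subset> D \<and> (\<forall>i\<in>I. agree_near X (T\<^sub>D i) (T i)) \<and>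
     holomorphic_map_system D I T\<^sub>D"

definition weight_extension ::
    "(complex ^ 'd) set \<Rightarrow> 'i set \<Rightarrow> ('i \<Rightarrow> complex ^ 'd \<Rightarrow> complex) \<Rightarrow>
     (complex ^ 'd) set \<Rightarrow> ('i \<Rightarrow> complex ^ 'd \<Rightarrow> complex) \<Rightarrow> bool" where
  "weight_extension X I w D w\<^sub>D \<longleftrightarrow>
     bounded_domain D \<and> X \<subset>\<subset> D \<and> (\<forall>i\<in>I. agree_near X (w\<^sub>D i) (w i)) \<and>
     holomorphic_weight_system D I w\<^sub>D"

definition analytic_map_system ::
    "(complex ^ 'd) set \<Rightarrow> 'i set \<Rightarrow> ('i \<Rightarrow> complex ^ 'd \<Rightarrow> complex ^ 'd) \<Rightarrow> bool" where
  "analytic_map_system X I T \<longleftrightarrow>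
     (\<forall>i\<in>I. T i ` X \<subseteq> X) \<and> (\<exists>D T\<^sub>D. map_extension X I T D T\<^sub>D)"

definition analytic_weight_system ::
    "(complex ^ 'd) set \<Rightarrow> 'i set \<Rightarrow> ('i \<Rightarrow> complex ^ 'd \<Rightarrow> complex) \<Rightarrow> bool" where
  "analytic_weight_system X I w \<longleftrightarrow> (\<exists>D w\<^sub>D. weight_extension X I w D w\<^sub>D)"

definition analytic_map_weight_system ::
    "(complex ^ 'd) set \<Rightarrow> 'i set \<Rightarrow> ('i \<Rightarrow> complex ^ 'd \<Rightarrow> complex ^ 'd) \<Rightarrow>
     ('i \<Rightarrow> complex ^ 'd \<Rightarrow> complex) \<Rightarrow> bool" where
  "analytic_map_weight_system X I T w \<longleftrightarrow>
     analytic_map_system X I T \<and> analytic_weight_system X I w"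

(* D is admissible for the map-weight system, and T_D, w_D are the extensions to D
   (which are unique on the closure of D, as D is connected and X non-empty). *)
definition admissible_with ::
    "(complex ^ 'd) set \<Rightarrow> 'i set \<Rightarrow> ('i \<Rightarrow> complex ^ 'd \<Rightarrow> complex ^ 'd) \<Rightarrow>
     ('i \<Rightarrow> complex ^ 'd \<Rightarrow> complex) \<Rightarrow> (complex ^ 'd) set \<Rightarrow>
     ('i \<Rightarrow> complex ^ 'd \<Rightarrow> complex ^ 'd) \<Rightarrow> ('i \<Rightarrow> complex ^ 'd \<Rightarrow> complex) \<Rightarrow> bool" where
  "admissible_with X I T w D T\<^sub>D w\<^sub>D \<longleftrightarrow>
     map_extension X I T D T\<^sub>D \<and> weight_extension X I w D w\<^sub>D"

(* Elements of the type of bounded operators are only real-linear; the derivatives below are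
   complex-linear because the maps are holomorphic.  Their type-class norm is the operator norm. *)
definition scale_op ::
    "complex \<Rightarrow> ((complex ^ 'd) \<Rightarrow>\<^sub>L (complex ^ 'd)) \<Rightarrow> ((complex ^ 'd) \<Rightarrow>\<^sub>L (complex ^ 'd))" where
  "scale_op c G = Blinfun (\<lambda>v. c *s blinfun_apply G v)"

(* For a word [i1, ..., in], fold T [i1, ..., in] is T in o ... o T i1.  It is meaningful as a
   germ along X, and F is its holomorphic extension to D, with derivative F'. *)
definition complex_contracting ::
    "(complex ^ 'd) set \<Rightarrow> 'i set \<Rightarrow> ('i \<Rightarrow> complex ^ 'd \<Rightarrow> complex ^ 'd) \<Rightarrow> bool" where
  "complex_contracting X I T \<longleftrightarrow>
     (\<exists>n>0. \<exists>D. bounded_domain D \<and> X \<subset>\<subset> D \<and>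
       (\<exists>(F :: 'i list \<Rightarrow> complex ^ 'd \<Rightarrow> complex ^ 'd)
          (F' :: 'i list \<Rightarrow> complex ^ 'd \<Rightarrow> ((complex ^ 'd) \<Rightarrow>\<^sub>L (complex ^ 'd))).
         (\<forall>is. length is = n \<and> set is \<subseteq> I \<longrightarrow>
            agree_near X (F is) (fold T is) \<and>
            holomorphic_map (*s) (F is) D \<and>
            (\<forall>z\<in>D. (F is has_derivative blinfun_apply (F' is z)) (at z)) \<and>
            in_U scale_op D (F' is)) \<and>
         (\<exists>c<1. \<forall>is. length is = n \<and> set is \<subseteq> I \<longrightarrow> U_norm D (F' is) \<le> c)))"

interpretation cfun: vector_space "\<lambda>(c::complex) (f::'a \<Rightarrow> complex) z. c * f z"
  by unfold_locales (auto simp: fun_eq_iff algebra_simps)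

definition banach_function_space :: "('a \<Rightarrow> complex) set \<Rightarrow> (('a \<Rightarrow> complex) \<Rightarrow> real) \<Rightarrow> bool" where
  "banach_function_space A N \<longleftrightarrow>
     cfun.subspace A \<and>
     (\<forall>f\<in>A. 0 \<le> N f \<and> (N f = 0 \<longleftrightarrow> f = 0)) \<and>
     (\<forall>f\<in>A. \<forall>g\<in>A. N (f + g) \<le> N f + N g) \<and>
     (\<forall>c. \<forall>f\<in>A. N (\<lambda>z. c * f z) = cmod c * N f) \<and>
     Metric_space.mcomplete A (\<lambda>f g. N (f - g))"

(* The space has carrier A and norm N; functions on D are represented by total functions vanishing
   outside D.  The last two clauses say that the embedding of U(D) has operator norm exactly 1. *)
definition favourable_space ::
    "(complex ^ 'd) set \<Rightarrow> (complex ^ 'd \<Rightarrow> complex) set \<Rightarrow>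
     ((complex ^ 'd \<Rightarrow> complex) \<Rightarrow> real) \<Rightarrow> bool" where
  "favourable_space D A N \<longleftrightarrow>
     banach_function_space A N \<and>
     (\<forall>f\<in>A. holomorphic_map (*) f D \<and> (\<forall>z. z \<notin> D \<longrightarrow> f z = 0)) \<and>
     (\<forall>z\<in>D. continuous_map (Metric_space.mtopology A (\<lambda>f g. N (f - g))) euclidean (\<lambda>f. f z)) \<and>
     restrict_zero D ` U_space D \<subseteq> A \<and>
     (\<forall>f\<in>U_space D. N (restrict_zero D f) \<le> U_norm D f) \<and>
     (\<forall>c. (\<forall>f\<in>U_space D. N (restrict_zero D f) \<le> c * U_norm D f) \<longrightarrow> 1 \<le> c)"

(* S is the set on which the functions live: D for spaces of functions on D, and the closure of D
   for U(D). *)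
definition transfer_operator ::
    "(complex ^ 'd) set \<Rightarrow> 'i set \<Rightarrow> ('i \<Rightarrow> complex ^ 'd \<Rightarrow> complex ^ 'd) \<Rightarrow>
     ('i \<Rightarrow> complex ^ 'd \<Rightarrow> complex) \<Rightarrow> (complex ^ 'd \<Rightarrow> complex) \<Rightarrow> complex ^ 'd \<Rightarrow> complex" where
  "transfer_operator S I T w f = restrict_zero S (\<lambda>z. \<Sum>\<^sub>\<infinity>i\<in>I. w i z * f (T i z))"

definition generalized_eigenspace ::
    "('a \<Rightarrow> complex) set \<Rightarrow> (('a \<Rightarrow> complex) \<Rightarrow> 'a \<Rightarrow> complex) \<Rightarrow> complex \<Rightarrow> ('a \<Rightarrow> complex) set" where
  "generalized_eigenspace A L \<mu> =
     {f \<in> A. \<exists>k. ((\<lambda>g. L g - (\<lambda>z. \<mu> * g z)) ^^ k) f = 0}"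

(* The library dimension of an infinite-dimensional space is 0, hence the case distinction. *)
definition algebraic_multiplicity ::
    "('a \<Rightarrow> complex) set \<Rightarrow> (('a \<Rightarrow> complex) \<Rightarrow> 'a \<Rightarrow> complex) \<Rightarrow> complex \<Rightarrow> enat" where
  "algebraic_multiplicity A L \<mu> =
     (if \<exists>B. finite B \<and> generalized_eigenspace A L \<mu> \<subseteq> cfun.span B
      then enat (cfun.dim (generalized_eigenspace A L \<mu>)) else \<infinity>)"

(* All admissible orderings of the eigenvalue sequence of L on A.  As the moduli decrease,
   zeros can occur only after all non-zero eigenvalues have been listed; mu is an eigenvalue
   iff its multiplicity is positive. *)
definition eigenvalue_sequences ::
    "('a \<Rightarrow> complex) set \<Rightarrow> (('a \<Rightarrow> complex) \<Rightarrow> 'a \<Rightarrow> complex) \<Rightarrow> (nat \<Rightarrow> complex) set" where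
  "eigenvalue_sequences A L =
     {s. decseq (\<lambda>n. cmod (s n)) \<and>
         (\<forall>\<mu>. \<mu> \<noteq> 0 \<longrightarrow> finite {n. s n = \<mu>} \<and>
                enat (card {n. s n = \<mu>}) = algebraic_multiplicity A L \<mu>)}"

end

theory Submission
  imports Defs "HOL-Complex_Analysis.Great_Picard"
begin

text \<open>For an admissible domain \<open>D\<close> the images of \<open>D\<close> under the compositions \<open>T\<close> along words
  of length \<open>n\<close> shrink uniformly to \<open>X\<close> as \<open>n\<close> grows; this is the argument of Earle and Hamilton
  and holds on every bounded domain with \<open>T\<^sub>i(D)\<close> compactly inside \<open>D\<close>. Hence \<open>L\<^sup>n p\<close>,
  as a sum over words of length \<open>n\<close>, makes sense on any other admissible domain \<open>D'\<close> as soon as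
  \<open>p\<close> is holomorphic near \<open>X\<close>. On a generalized eigenspace for \<open>\<mu> \<noteq> 0\<close> the operator \<open>L\<close> is
  surjective, so each generalized eigenfunction \<open>f = L\<^sup>n p\<close> on \<open>D\<close> has the same germ along \<open>X\<close>
  as a generalized eigenfunction on \<open>D'\<close>, which is unique by the identity theorem. Exchanging the
  roles of \<open>D\<close> and \<open>D'\<close> gives an isomorphism of generalized eigenspaces. That an eigenvalue
  sequence exists follows from the Riesz theory of the compact operator on \<open>U(D)\<close>.\<close>

section \<open>Holomorphic maps of several variables\<close>

text \<open>Restriction cannot compare two admissible domains \<open>D\<close> and
  \<open>D'\<close>: their intersection may be disconnected, and the two extensions may differ on
  components that miss \<open>X\<close>. What is shared is the germ along \<open>X\<close>, so the
  comparison goes eigenfunction by eigenfunction through germs. The order of choices matters: the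
  radius around \<open>X\<close> within which the two systems agree has to serve words of every
  length, because the length that brings \<open>D'\<close> into that neighbourhood is chosen after
  it. The contraction must also be uniform over words, of which there may be infinitely many of each
  length. Favourable spaces enter through two facts: their elements are holomorphic on
  \<open>D\<close>, and they contain the restrictions of \<open>U(D)\<close>. Compactness is
  established on \<open>U(D)\<close>, and finiteness of the multiplicities is carried to the other
  spaces by the isomorphism.\<close>

lemma norm_vector_smult: "norm (c *s v) = cmod c * norm v" for v :: "complex ^ 'd"
  by (simp add: norm_vec_def L2_set_def norm_mult power_mult_distrib real_sqrt_mult
      flip: sum_distrib_left)

lemma bounded_linear_smult: "bounded_linear (\<lambda>c. c *s v)" for v :: "complex ^ 'd"
  by (rule bounded_linear_intro[where K = "norm v"])
     (auto simp: norm_vector_smult vec_eq_iff algebra_simps)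

text \<open>Complex linearity of the derivative is what turns the restriction to a complex line into
  a one-variable holomorphic function; one-variable theorems are imported through such
  lines.\<close>

lemma slice_has_field_derivative:
  fixes a v :: "complex ^ 'd"
  assumes "(f has_derivative f') (at (a + t *s v))" and lin: "\<And>c v. f' (c *s v) = c * f' v"
  shows "((\<lambda>t. f (a + t *s v)) has_field_derivative f' v) (at t)"
proof -
  have "((\<lambda>t. a + t *s v) has_derivative (\<lambda>h. h *s v)) (at t)"
    using bounded_linear_imp_has_derivative[OF bounded_linear_smult]
      has_derivative_add[OF has_derivative_const] by fastforce
  from has_derivative_compose[OF this assms(1)] show ?thesis
    unfolding has_field_derivative_def lin mult.commute[of "f' v"] .
qed

lemma holomorphic_mapE:
  assumes "holomorphic_map scl f D" "z \<in> D"
  obtains f' where "(f has_derivative f') (at z)" "\<And>c v. f' (c *s v) = scl c (f' v)"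
  using assms unfolding holomorphic_map_def by blast

lemma slice_holomorphic_on:
  assumes "holomorphic_map (*) f D"
  shows "(\<lambda>t. f (a + t *s v)) holomorphic_on {t. a + t *s v \<in> D}"
proof (rule holomorphic_onI)
  fix t assume "t \<in> {t. a + t *s v \<in> D}"
  then obtain f' where "(f has_derivative f') (at (a + t *s v))" "\<And>c v. f' (c *s v) = c * f' v"
    using assms holomorphic_mapE by blast
  from slice_has_field_derivative[OF this]
  show "(\<lambda>t. f (a + t *s v)) field_differentiable at t within {t. a + t *s v \<in> D}"
    by (meson field_differentiable_at_within field_differentiable_def)
qed

lemma holomorphic_map_subset: "holomorphic_map scl f D \<Longrightarrow> E \<subseteq> D \<Longrightarrow> holomorphic_map scl f E"
  unfolding holomorphic_map_def by blast

lemma holomorphic_map_continuous_on: "holomorphic_map scl f D \<Longrightarrow> continuous_on D f"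
  unfolding holomorphic_map_def
  by (meson continuous_at_imp_continuous_on has_derivative_continuous)

lemma holomorphic_map_cong:
  assumes "holomorphic_map scl f D" "open D" "\<And>z. z \<in> D \<Longrightarrow> f z = g z"
  shows "holomorphic_map scl g D"
  unfolding holomorphic_map_def
  by (metis assms has_derivative_transform_within_open holomorphic_mapE)

lemma holomorphic_map_compose:
  assumes f: "holomorphic_map scl f E" and g: "holomorphic_map (*s) g D" and "g ` D \<subseteq> E"
  shows "holomorphic_map scl (\<lambda>z. f (g z)) D"
  unfolding holomorphic_map_def
proof
  fix z assume z: "z \<in> D"
  obtain g' where g': "(g has_derivative g') (at z)" "\<And>c v. g' (c *s v) = c *s g' v"
    using g z holomorphic_mapE by blast
  obtain f' where f': "(f has_derivative f') (at (g z))" "\<And>c v. f' (c *s v) = scl c (f' v)"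
    using f z assms(3) holomorphic_mapE by blast
  show "\<exists>f'. ((\<lambda>z. f (g z)) has_derivative f') (at z) \<and> (\<forall>c v. f' (c *s v) = scl c (f' v))"
    using has_derivative_compose[OF g'(1) f'(1)] by (intro exI conjI) (auto simp: g'(2) f'(2))
qed

lemma holomorphic_map_component:
  fixes f :: "complex ^ 'd \<Rightarrow> complex ^ 'e"
  assumes "holomorphic_map (*s) f D"
  shows "holomorphic_map (*) (\<lambda>z. f z $ k) D"
  unfolding holomorphic_map_def
proof
  fix z assume "z \<in> D"
  then obtain f' where f': "(f has_derivative f') (at z)" "\<And>c v. f' (c *s v) = c *s f' v"
    using assms holomorphic_mapE by blast
  show "\<exists>f'. ((\<lambda>z. f z $ k) has_derivative f') (at z) \<and> (\<forall>c v. f' (c *s v) = c * f' v)"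
    using bounded_linear.has_derivative[OF bounded_linear_vec_nth f'(1)]
    by (intro exI conjI) (auto simp: f'(2))
qed

lemma holomorphic_map_add:
  assumes f: "holomorphic_map scl f D" and g: "holomorphic_map scl g D"
    and scl: "\<And>c u v. scl c (u + v) = scl c u + scl c v"
  shows "holomorphic_map scl (\<lambda>z. f z + g z) D"
  unfolding holomorphic_map_def
proof
  fix z assume z: "z \<in> D"
  obtain g' where g': "(g has_derivative g') (at z)" "\<And>c v. g' (c *s v) = scl c (g' v)"
    using g z holomorphic_mapE by blast
  obtain f' where f': "(f has_derivative f') (at z)" "\<And>c v. f' (c *s v) = scl c (f' v)"
    using f z holomorphic_mapE by blast
  show "\<exists>f'. ((\<lambda>z. f z + g z) has_derivative f') (at z) \<and> (\<forall>c v. f' (c *s v) = scl c (f' v))"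
    using has_derivative_add[OF f'(1) g'(1)] by (intro exI conjI) (auto simp: g'(2) f'(2) scl)
qed

lemma holomorphic_map_mult:
  assumes f: "holomorphic_map (*) f D" and g: "holomorphic_map (*) g D"
  shows "holomorphic_map (*) (\<lambda>z. f z * g z) D"
  unfolding holomorphic_map_def
proof
  fix z assume z: "z \<in> D"
  obtain g' where g': "(g has_derivative g') (at z)" "\<And>c v. g' (c *s v) = c * g' v"
    using g z holomorphic_mapE by blast
  obtain f' where f': "(f has_derivative f') (at z)" "\<And>c v. f' (c *s v) = c * f' v"
    using f z holomorphic_mapE by blast
  show "\<exists>f'. ((\<lambda>z. f z * g z) has_derivative f') (at z) \<and> (\<forall>c v. f' (c *s v) = c * f' v)"
    using has_derivative_mult[OF f'(1) g'(1)]
    by (intro exI conjI) (auto simp: g'(2) f'(2) algebra_simps)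
qed

lemma holomorphic_map_const: "holomorphic_map (*) (\<lambda>z. c) D"
  unfolding holomorphic_map_def by (auto intro!: exI[of _ "\<lambda>_. 0"])

lemma holomorphic_map_id: "holomorphic_map (*s) (\<lambda>z. z) D"
  unfolding holomorphic_map_def by (auto intro!: exI[of _ "\<lambda>z. z"])

lemma holomorphic_map_smult:
  fixes f :: "complex ^ 'd \<Rightarrow> complex ^ 'e"
  assumes f: "holomorphic_map (*s) f D"
  shows "holomorphic_map (*s) (\<lambda>z. c *s f z) D"
  unfolding holomorphic_map_def
proof
  fix z assume "z \<in> D"
  then obtain f' where f': "(f has_derivative f') (at z)" "\<And>c v. f' (c *s v) = c *s f' v"
    using assms holomorphic_mapE by blast
  have "bounded_linear (\<lambda>v::complex ^ 'e. c *s v)"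
    by (rule bounded_linear_intro[where K = "cmod c"])
       (auto simp: norm_vector_smult vec_eq_iff algebra_simps)
  from bounded_linear.has_derivative[OF this f'(1)]
  show "\<exists>f'. ((\<lambda>z. c *s f z) has_derivative f') (at z) \<and> (\<forall>c v. f' (c *s v) = c *s f' v)"
    by (intro exI conjI) (auto simp: f'(2) vec_eq_iff)
qed

lemma holomorphic_map_const_vec: "holomorphic_map (*s) (\<lambda>z. c) D"
  unfolding holomorphic_map_def by (auto intro!: exI[of _ "\<lambda>_. 0"])

lemma holomorphic_map_diff:
  assumes f: "holomorphic_map (*) f D" and g: "holomorphic_map (*) g D"
  shows "holomorphic_map (*) (\<lambda>z. f z - g z) D"
  using holomorphic_map_add[OF f holomorphic_map_mult[OF holomorphic_map_const g, of "-1"]]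
  by (simp add: algebra_simps)

text \<open>The complex line through \<open>z\<close> in direction \<open>v\<close> maps the disc of
  radius \<open>r / norm v\<close> into \<open>cball z r\<close>, so the one-variable Cauchy
  inequality applies on it.\<close>

lemma Cauchy_derivative_bound:
  fixes z :: "complex ^ 'd"
  assumes f: "holomorphic_map (*) f D" and D: "cball z r \<subseteq> D" and r: "0 < r"
    and M: "\<And>x. x \<in> cball z r \<Longrightarrow> cmod (f x) \<le> M"
    and f': "(f has_derivative f') (at z)" "\<And>c v. f' (c *s v) = c * f' v"
  shows "cmod (f' v) \<le> M / r * norm v"
proof (cases "v = 0")
  case True
  then show ?thesis using f'(2)[of 0 0] by simp
next
  case False
  define R where "R = r / norm v"
  have R: "R > 0" using r False by (simp add: R_def)
  have in_ball: "z + t *s v \<in> cball z r" if "t \<in> cball 0 R" for t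
    using that False by (simp add: dist_norm norm_vector_smult R_def field_simps)
  have hol: "(\<lambda>t. f (z + t *s v)) holomorphic_on cball 0 R"
    by (rule holomorphic_on_subset[OF slice_holomorphic_on[OF f]]) (use in_ball D in auto)
  have "((\<lambda>t. f (z + t *s v)) has_field_derivative f' v) (at 0)"
    by (rule slice_has_field_derivative) (use f' in auto)
  then have "deriv (\<lambda>t. f (z + t *s v)) 0 = f' v"
    by (rule DERIV_imp_deriv)
  moreover have "norm ((deriv ^^ 1) (\<lambda>t. f (z + t *s v)) 0) \<le> fact 1 * M / R ^ 1"
  proof (rule Cauchy_inequality)
    show "(\<lambda>t. f (z + t *s v)) holomorphic_on ball 0 R"
      using hol by (rule holomorphic_on_subset) auto
    show "cmod (f (z + x *s v)) \<le> M" if "cmod (0 - x) = R" for x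
      using that by (intro M in_ball) simp
  qed (use R hol holomorphic_on_imp_continuous_on in auto)
  ultimately show ?thesis by (simp add: R_def)
qed

text \<open>Each point of \<open>cball z r\<close> is the centre of a ball of radius
  \<open>r\<close> inside \<open>cball z (2 * r)\<close>, which is why the bound is assumed on the
  double ball; the mean value inequality on the smaller, convex ball does the rest.\<close>

lemma holomorphic_map_Lipschitz:
  fixes z :: "complex ^ 'd"
  assumes f: "holomorphic_map (*) f D" and D: "cball z (2 * r) \<subseteq> D" and r: "0 < r"
    and M: "\<And>x. x \<in> cball z (2 * r) \<Longrightarrow> cmod (f x) \<le> M"
    and x: "x \<in> cball z r" and y: "y \<in> cball z r"
  shows "cmod (f x - f y) \<le> M / r * norm (x - y)"
proof -
  have sub: "cball a r \<subseteq> cball z (2 * r)" if "a \<in> cball z r" for a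
    using that by (simp add: cball_subset_cball_iff dist_commute)
  have "\<forall>a\<in>cball z r. \<exists>f'. (f has_derivative f') (at a) \<and> (\<forall>c v. f' (c *s v) = c * f' v)"
    using holomorphic_map_subset[OF f order_trans[OF subset_cball D], of r] r
    by (auto simp: holomorphic_map_def)
  then obtain F' where F': "\<And>a. a \<in> cball z r \<Longrightarrow> (f has_derivative F' a) (at a)"
      "\<And>a c v. a \<in> cball z r \<Longrightarrow> F' a (c *s v) = c * F' a v"
    by metis
  show ?thesis
  proof (rule differentiable_bound[OF convex_cball _ _ x y])
    show "(f has_derivative F' a) (at a within cball z r)" if "a \<in> cball z r" for a
      using F'(1)[OF that] has_derivative_at_withinI by blast
    show "onorm (F' a) \<le> M / r" if a: "a \<in> cball z r" for a
      using Cauchy_derivative_bound[OF f order_trans[OF sub[OF a] D] r _ F'(1)[OF a] F'(2)[OF a]]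
        M sub[OF a] by (intro onorm_le) blast
  qed
qed

text \<open>Coordinates are treated separately and their moduli added, which costs the factor
  \<open>CARD('e)\<close>.\<close>

lemma holomorphic_map_Lipschitz_vec:
  fixes z :: "complex ^ 'd" and f :: "complex ^ 'd \<Rightarrow> complex ^ 'e"
  assumes f: "holomorphic_map (*s) f D" and D: "cball z (2 * r) \<subseteq> D" and r: "0 < r"
    and M: "\<And>x. x \<in> cball z (2 * r) \<Longrightarrow> norm (f x) \<le> M"
    and x: "x \<in> cball z r" and y: "y \<in> cball z r"
  shows "norm (f x - f y) \<le> CARD('e) * (M / r) * norm (x - y)"
proof -
  have "norm (f x - f y) \<le> (\<Sum>k\<in>UNIV. cmod ((f x - f y) $ k))"
    unfolding norm_vec_def by (rule L2_set_le_sum) simp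
  also have "\<dots> \<le> (\<Sum>k\<in>(UNIV :: 'e set). M / r * norm (x - y))"
  proof (rule sum_mono)
    fix k :: 'e
    have "cmod (f a $ k) \<le> M" if "a \<in> cball z (2 * r)" for a
      using M[OF that] Finite_Cartesian_Product.norm_nth_le order_trans by blast
    from holomorphic_map_Lipschitz[OF holomorphic_map_component[OF f] D r this x y]
    show "cmod ((f x - f y) $ k) \<le> M / r * norm (x - y)" by simp
  qed
  finally show ?thesis by (simp add: mult.assoc)
qed

text \<open>The interior of the zero set is clopen in \<open>D\<close>. Closedness hinges on balls:
  within a ball, any point is joined to an interior zero by a complex line, and the one-variable
  identity theorem acts on that line.\<close>

lemma holomorphic_map_identity:
  fixes D :: "(complex ^ 'd) set"
  assumes f: "holomorphic_map (*) f D" and D: "open D" "connected D"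
    and V: "open V" "V \<noteq> {}" "V \<subseteq> D" "\<And>z. z \<in> V \<Longrightarrow> f z = 0"
    and z: "z \<in> D"
  shows "f z = 0"
proof -
  define Z where "Z = interior {z\<in>D. f z = 0}"
  have "Z \<subseteq> D" using interior_subset by (auto simp: Z_def)
  have "V \<subseteq> Z" unfolding Z_def by (rule interior_maximal) (use V in auto)
  have ball_in_Z: "ball y r \<subseteq> Z" if y: "ball y r \<subseteq> D" "ball y r \<inter> Z \<noteq> {}" for y r
  proof -
    obtain a where a: "a \<in> ball y r" "a \<in> Z" using y by blast
    have "f x = 0" if x: "x \<in> ball y r" for x
    proof -
      define S where "S = {t. a + t *s (x - a) \<in> ball y r}"
      define W where "W = {t. a + t *s (x - a) \<in> Z \<inter> ball y r}"
      have cont: "continuous_on UNIV (\<lambda>t. a + t *s (x - a))"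
        by (intro continuous_intros bounded_linear.continuous_on[OF bounded_linear_smult])
      \<comment> \<open>The line is at the interior zero \<open>a\<close> for parameter 0 and at
        \<open>x\<close> for parameter 1; its part \<open>S\<close> in the ball is convex, hence
        connected.\<close>
      have "(\<lambda>t. f (a + t *s (x - a))) 1 = 0"
      proof (rule analytic_continuation_open[of W S "\<lambda>t. f (a + t *s (x - a))" "\<lambda>_. 0"])
        show "open S"
          using open_vimage[OF open_ball cont] by (simp add: S_def vimage_def)
        show "open W"
          using open_vimage[of "Z \<inter> ball y r", OF _ cont] by (simp add: W_def vimage_def Z_def open_Int)
        show "connected S"
        proof (rule convex_connected, rule convexI)
          fix u v :: real and p q
          assume *: "p \<in> S" "q \<in> S" "0 \<le> u" "0 \<le> v" "u + v = 1"
          have "(u *\<^sub>R p + v *\<^sub>R q) *s (x - a) = u *\<^sub>R (p *s (x - a)) + v *\<^sub>R (q *s (x - a))"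
            by (simp add: vec_eq_iff algebra_simps)
          moreover have "a = u *\<^sub>R a + v *\<^sub>R a"
            using \<open>u + v = 1\<close> by (simp flip: scaleR_left_distrib)
          ultimately have "a + (u *\<^sub>R p + v *\<^sub>R q) *s (x - a)
              = u *\<^sub>R (a + p *s (x - a)) + v *\<^sub>R (a + q *s (x - a))"
            unfolding scaleR_add_right by (metis (no_types, lifting) add.assoc add.left_commute)
          then show "u *\<^sub>R p + v *\<^sub>R q \<in> S"
            using * convexD[OF convex_ball[of y r]] by (simp add: S_def del: mem_ball)
        qed
        show "W \<noteq> {}" using a by (auto simp: W_def intro!: exI[of _ 0])
        show "W \<subseteq> S" by (auto simp: W_def S_def)
        show "(\<lambda>t. f (a + t *s (x - a))) holomorphic_on S"
          by (rule holomorphic_on_subset[OF slice_holomorphic_on[OF f]]) (use y in \<open>auto simp: S_def\<close>)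
        show "f (a + t *s (x - a)) = 0" if "t \<in> W" for t
          using that interior_subset by (auto simp: W_def Z_def)
        show "1 \<in> S" using x by (simp add: S_def)
      qed auto
      then show ?thesis by simp
    qed
    then show ?thesis unfolding Z_def by (intro interior_maximal) (use y in auto)
  qed
  have "closedin (top_of_set D) Z"
  proof -
    have "y \<in> Z" if y: "y \<in> D" "y \<in> closure Z" for y
    proof -
      obtain r where r: "r > 0" "ball y r \<subseteq> D" using D y open_contains_ball by blast
      have "ball y r \<inter> Z \<noteq> {}"
        using y(2) r(1) closure_approachable[of y Z] by (metis dist_commute disjoint_iff mem_ball)
      then show ?thesis using ball_in_Z r by (meson centre_in_ball subsetD)
    qed
    then have "Z = D \<inter> closure Z" using \<open>Z \<subseteq> D\<close> closure_subset by auto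
    then show ?thesis by (metis closedin_closed_Int closed_closure)
  qed
  moreover have "openin (top_of_set D) Z"
    using \<open>Z \<subseteq> D\<close> by (simp add: Z_def open_subset)
  ultimately have "Z = D"
    using D \<open>V \<subseteq> Z\<close> V connected_clopen by blast
  then show ?thesis using z interior_subset by (auto simp: Z_def)
qed

section \<open>Unordered sums of holomorphic functions\<close>

lemma continuous_on_infsum:
  fixes f :: "'i \<Rightarrow> 'a::topological_space \<Rightarrow> 'b::banach"
  assumes "\<And>i. i \<in> I \<Longrightarrow> continuous_on S (f i)"
    and "\<And>i x. i \<in> I \<Longrightarrow> x \<in> S \<Longrightarrow> norm (f i x) \<le> b i" and "b summable_on I"
  shows "continuous_on S (\<lambda>x. \<Sum>\<^sub>\<infinity>i\<in>I. f i x)"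
proof (rule uniform_limit_theorem[OF _ Weierstrass_m_test_general])
  show "\<forall>\<^sub>F F in finite_subsets_at_top I. continuous_on S (\<lambda>x. \<Sum>i\<in>F. f i x)"
    by (intro eventually_finite_subsets_at_top_weakI continuous_on_sum) (use assms in auto)
qed (use assms in auto)

lemma abs_summable_bound:
  fixes f :: "'i \<Rightarrow> 'b::banach"
  assumes "b summable_on I" and "\<And>i. i \<in> I \<Longrightarrow> norm (f i) \<le> b i"
  shows "f abs_summable_on I" "f summable_on I"
proof -
  show "f abs_summable_on I"
    using assms by (rule Infinite_Sum.abs_summable_on_comparison_test')
  then show "f summable_on I" by (rule abs_summable_summable)
qed

lemma norm_infsum_le_bound:
  fixes f :: "'i \<Rightarrow> 'b::banach"
  assumes b: "b summable_on I" and le: "\<And>i. i \<in> I \<Longrightarrow> norm (f i) \<le> b i"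
  shows "norm (infsum f I) \<le> infsum b I"
  using norm_infsum_bound[OF abs_summable_bound(1)[OF assms]]
    infsum_mono[OF abs_summable_bound(1)[OF assms] b le] by linarith

lemma summable_on_diff:
  fixes f g :: "'i \<Rightarrow> 'b::topological_ab_group_add"
  assumes "f summable_on I" "g summable_on I"
  shows "(\<lambda>i. f i - g i) summable_on I"
  using summable_on_add[of f I "\<lambda>i. - g i"] assms by (simp add: summable_on_uminus)

lemma infsum_diff:
  fixes f g :: "'i \<Rightarrow> 'b::{topological_ab_group_add, t2_space}"
  assumes "f summable_on I" "g summable_on I"
  shows "infsum (\<lambda>i. f i - g i) I = infsum f I - infsum g I"
  using infsum_add[of f I "\<lambda>i. - g i"] assms by (simp add: infsum_uminus summable_on_uminus)

text \<open>Termwise differentiation. The remainder quotients \<open>q i\<close>, with value 0 at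
  \<open>z\<close>, are continuous and dominated by \<open>b i / r * 2\<close>, so by the
  Weierstrass test their sum is continuous at \<open>z\<close>; this says that \<open>g\<close> is
  the derivative of the sum.\<close>

lemma holomorphic_map_infsum:
  fixes f :: "'i \<Rightarrow> complex ^ 'd \<Rightarrow> complex"
  assumes hol: "\<And>i. i \<in> I \<Longrightarrow> holomorphic_map (*) (f i) D" and "open D"
    and b: "\<And>i z. i \<in> I \<Longrightarrow> z \<in> D \<Longrightarrow> cmod (f i z) \<le> b i" "b summable_on I"
  shows "holomorphic_map (*) (\<lambda>z. \<Sum>\<^sub>\<infinity>i\<in>I. f i z) D"
  unfolding holomorphic_map_def
proof
  fix z assume z: "z \<in> D"
  obtain R where R: "R > 0" "cball z R \<subseteq> D" using z \<open>open D\<close> open_contains_cball by blast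
  define r where "r = R / 2"
  have r: "r > 0" "cball z (2 * r) \<subseteq> D" "cball z r \<subseteq> D"
    using R cball_subset_cball_iff[of z r z R] by (auto simp: r_def)
  have "\<forall>i\<in>I. \<exists>f'. (f i has_derivative f') (at z) \<and> (\<forall>c v. f' (c *s v) = c * f' v)"
    using hol z unfolding holomorphic_map_def by auto
  then obtain f' where f': "\<And>i. i \<in> I \<Longrightarrow> (f i has_derivative f' i) (at z)"
      "\<And>i c v. i \<in> I \<Longrightarrow> f' i (c *s v) = c * f' i v"
    by metis
  have f'_bound: "cmod (f' i v) \<le> b i / r * norm v" if "i \<in> I" for i v
    using Cauchy_derivative_bound[OF hol r(3) r(1) _ f'] that b r by blast
  have sum_b: "(\<lambda>i. b i / r * c) summable_on I" for c
    using summable_on_cmult_left[OF b(2), of "c / r"] by simp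
  note sum_f' = abs_summable_bound(2)[OF sum_b f'_bound]
  have sum_f: "(\<lambda>i. f i x) summable_on I" if "x \<in> D" for x
    by (rule abs_summable_bound(2)[OF b(2) b(1)]) (use that in auto)
  define g where "g v = (\<Sum>\<^sub>\<infinity>i\<in>I. f' i v)" for v
  have lin_f': "linear (f' i)" if "i \<in> I" for i
    using f'(1)[OF that] has_derivative_linear by blast
  have "bounded_linear g"
  proof (rule bounded_linear_intro)
    show "g (x + y) = g x + g y" for x y
      unfolding g_def by (subst infsum_add[symmetric]) (auto intro!: infsum_cong sum_f' linear_add lin_f')
    show "g (c *\<^sub>R x) = c *\<^sub>R g x" for c x
      unfolding g_def infsum_scaleR_right[symmetric]
      by (intro infsum_cong linear_scale lin_f')
    show "norm (g v) \<le> norm v * (\<Sum>\<^sub>\<infinity>i\<in>I. b i / r)" for v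
      unfolding g_def infsum_cmult_right'[symmetric]
      using norm_infsum_le_bound[OF sum_b f'_bound, of v] by (simp add: mult.commute)
  qed
  \<comment> \<open>Division by the norm of 0 yields 0, so \<open>q i z = 0\<close>, which is the
    limit required at \<open>z\<close>.\<close>
  define q where "q i x = (f i x - f i z - f' i (x - z)) /\<^sub>R norm (x - z)" for i x
  have q_cont: "continuous_on (cball z r) (q i)" if i: "i \<in> I" for i
  proof -
    have "continuous (at x within cball z r) (q i)" if x: "x \<in> cball z r" for x
    proof (cases "x = z")
      case True
      have "((\<lambda>x. (f i x - f i z - f' i (x - z)) /\<^sub>R norm (x - z)) \<longlongrightarrow> 0) (at z)"
        using f'(1)[OF i] unfolding has_derivative_def by (simp add: Lim_ident_at)
      then have "(q i \<longlongrightarrow> q i z) (at z)"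
        by (simp add: q_def[abs_def])
      then show ?thesis using True
        by (simp add: continuous_within tendsto_within_subset[OF _ subset_UNIV])
    next
      case False
      have "continuous_on D (f i)" using hol[OF i] by (rule holomorphic_map_continuous_on)
      then have 1: "isCont (f i) x" using x r \<open>open D\<close> continuous_on_eq_continuous_at by blast
      have "isCont (f' i) (x - z)"
        using f'(1)[OF i] has_derivative_bounded_linear linear_continuous_at by blast
      then have "isCont (\<lambda>x. f' i (x - z)) x"
        by (intro continuous_at_compose[of x "\<lambda>x. x - z" "f' i", unfolded o_def] continuous_intros)
      with 1 False have "isCont (q i) x" unfolding q_def[abs_def]
        by (intro continuous_intros) auto
      then show ?thesis by (rule continuous_at_imp_continuous_at_within)
    qed
    then show ?thesis by (simp add: continuous_on_eq_continuous_within)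
  qed
  have "continuous_on (cball z r) (\<lambda>x. \<Sum>\<^sub>\<infinity>i\<in>I. q i x)"
  proof (rule continuous_on_infsum[OF q_cont _ sum_b])
    fix i x assume i: "i \<in> I" and x: "x \<in> cball z r"
    have 0: "b i \<ge> 0" using b(1)[OF i z] norm_ge_zero order_trans by blast
    have "cmod (f i x - f i z) \<le> b i / r * norm (x - z)"
      by (rule holomorphic_map_Lipschitz[OF hol[OF i] r(2) r(1)]) (use b i r x in auto)
    with f'_bound[OF i, of "x - z"]
    have "cmod (f i x - f i z - f' i (x - z)) \<le> 2 * (b i / r * norm (x - z))"
      using norm_triangle_ineq4[of "f i x - f i z" "f' i (x - z)"] by linarith
    then show "norm (q i x) \<le> b i / r * 2"
      using 0 r by (cases "x = z") (auto simp: q_def divide_simps mult_ac)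
  qed
  moreover have "q i z = 0" for i by (simp add: q_def)
  ultimately have "((\<lambda>x. \<Sum>\<^sub>\<infinity>i\<in>I. q i x) \<longlongrightarrow> 0) (at z within cball z r)"
    using r unfolding continuous_on_def by (metis (no_types, lifting) centre_in_cball infsum_0 less_imp_le)
  then have lim: "((\<lambda>x. \<Sum>\<^sub>\<infinity>i\<in>I. q i x) \<longlongrightarrow> 0) (at z)"
    using at_within_interior[of z "cball z r"] r by simp
  have eq: "((\<Sum>\<^sub>\<infinity>i\<in>I. f i x) - (\<Sum>\<^sub>\<infinity>i\<in>I. f i z) - g (x - z)) /\<^sub>R norm (x - z) = (\<Sum>\<^sub>\<infinity>i\<in>I. q i x)"
    if "x \<in> cball z r" for x
  proof -
    have "x \<in> D" using that r by blast
    then have "(\<Sum>\<^sub>\<infinity>i\<in>I. f i x) - (\<Sum>\<^sub>\<infinity>i\<in>I. f i z) - g (x - z) = (\<Sum>\<^sub>\<infinity>i\<in>I. f i x - f i z - f' i (x - z))"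
      unfolding g_def using z by (simp add: infsum_diff summable_on_diff sum_f sum_f')
    then show ?thesis by (simp add: q_def infsum_scaleR_right)
  qed
  have "((\<lambda>x. \<Sum>\<^sub>\<infinity>i\<in>I. f i x) has_derivative g) (at z)"
    unfolding has_derivative_def
  proof
    have "\<forall>\<^sub>F x in at z. x \<in> cball z r"
      using r by (intro eventually_at_in_open'[of "ball z r", THEN eventually_mono]) auto
    then have "\<forall>\<^sub>F x in at z. ((\<Sum>\<^sub>\<infinity>i\<in>I. f i x) - (\<Sum>\<^sub>\<infinity>i\<in>I. f i z) - g (x - z)) /\<^sub>R norm (x - z)
        = (\<Sum>\<^sub>\<infinity>i\<in>I. q i x)"
      by (rule eventually_mono) (rule eq)
    from tendsto_cong[OF this] lim
    show "((\<lambda>y. (infsum (\<lambda>i. f i y) I - infsum (\<lambda>i. f i (Lim (at z) (\<lambda>x. x))) I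
        - g (y - Lim (at z) (\<lambda>x. x))) /\<^sub>R norm (y - Lim (at z) (\<lambda>x. x))) \<longlongrightarrow> 0) (at z)"
      by (simp add: Lim_ident_at)
  qed fact
  moreover have "g (c *s v) = c * g v" for c v
    unfolding g_def by (subst infsum_cmult_right'[symmetric]) (auto intro!: infsum_cong f')
  ultimately show "\<exists>f'. ((\<lambda>z. \<Sum>\<^sub>\<infinity>i\<in>I. f i z) has_derivative f') (at z) \<and> (\<forall>c v. f' (c *s v) = c * f' v)"
    by blast
qed

section \<open>Words of a map-weight system\<close>

lemma norm_le_U_norm:
  assumes "bounded D" "continuous_on (closure D) f" "z \<in> closure D"
  shows "norm (f z) \<le> U_norm D f"
  unfolding U_norm_def
proof (rule cSUP_upper[OF assms(3)])
  have "compact ((\<lambda>z. norm (f z)) ` closure D)"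
    using assms by (intro compact_continuous_image continuous_intros) auto
  then show "bdd_above ((\<lambda>z. norm (f z)) ` closure D)"
    by (simp add: bounded_imp_bdd_above compact_imp_bounded)
qed

lemma U_norm_least:
  assumes "D \<noteq> {}" "\<And>z. z \<in> closure D \<Longrightarrow> norm (f z) \<le> c"
  shows "U_norm D f \<le> c"
  unfolding U_norm_def using assms by (intro cSUP_least) auto

lemma weighted_composition_summable:
  fixes v :: "'j \<Rightarrow> 'a \<Rightarrow> complex" and S :: "'j \<Rightarrow> 'a \<Rightarrow> 'b"
  assumes "c summable_on J" and "\<And>j. j \<in> J \<Longrightarrow> cmod (v j z) \<le> c j"
    and "\<And>j. j \<in> J \<Longrightarrow> cmod (h (S j z)) \<le> M"
  shows "(\<lambda>j. v j z * h (S j z)) summable_on J"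
    and "cmod (\<Sum>\<^sub>\<infinity>j\<in>J. v j z * h (S j z)) \<le> infsum c J * M"
proof -
  have le: "cmod (v j z * h (S j z)) \<le> c j * M" if "j \<in> J" for j
    using mult_mono[OF assms(2)[OF that] assms(3)[OF that]] assms(2)[OF that]
    by (simp add: norm_mult) (meson norm_ge_zero order_trans)
  have sum: "(\<lambda>j. c j * M) summable_on J"
    using assms(1) by (rule summable_on_cmult_left)
  show "(\<lambda>j. v j z * h (S j z)) summable_on J"
    using sum le by (rule abs_summable_bound(2))
  show "cmod (\<Sum>\<^sub>\<infinity>j\<in>J. v j z * h (S j z)) \<le> infsum c J * M"
    using norm_infsum_le_bound[OF sum le] infsum_cmult_left'[of c M J] by simp
qed

text \<open>This is where regularity is gained: \<open>h\<close> is read on the compact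
  \<open>K\<close>, so it may behave badly near the boundary of its own domain, yet the sum is
  continuous up to the closure of \<open>D\<close>. Besides the transfer operator itself, it serves
  for sums over words with \<open>h\<close> living on a different domain.\<close>

lemma weighted_composition_in_U:
  fixes D :: "(complex ^ 'd) set" and h :: "complex ^ 'e \<Rightarrow> complex"
  assumes "open D"
    and S: "\<And>j. j \<in> J \<Longrightarrow> in_U (*s) D (S j)" "\<And>j. j \<in> J \<Longrightarrow> S j ` closure D \<subseteq> K"
    and v: "\<And>j. j \<in> J \<Longrightarrow> in_U (*) D (v j)"
    and c: "\<And>j z. j \<in> J \<Longrightarrow> z \<in> closure D \<Longrightarrow> cmod (v j z) \<le> c j" "c summable_on J"
    and h: "holomorphic_map (*) h E" and K: "compact K" "K \<subseteq> E"
  shows "in_U (*) D (\<lambda>z. \<Sum>\<^sub>\<infinity>j\<in>J. v j z * h (S j z))"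
proof -
  have hK: "continuous_on K h"
    using holomorphic_map_continuous_on[OF h] K(2) continuous_on_subset by blast
  then obtain M where M: "\<And>x. x \<in> K \<Longrightarrow> cmod (h x) \<le> M"
    using compact_continuous_image[OF hK K(1)] compact_imp_bounded
    by (metis bounded_iff imageI)
  have le: "cmod (v j z * h (S j z)) \<le> c j * M" if "j \<in> J" "z \<in> closure D" for j z
    using mult_mono[OF c(1)[OF that] M[of "S j z"]] S(2) that c(1)[OF that]
    by (simp add: norm_mult image_subset_iff) (meson norm_ge_zero order_trans)
  have sum: "(\<lambda>j. c j * M) summable_on J"
    using c(2) by (rule summable_on_cmult_left)
  show ?thesis
    unfolding in_U_def
  proof
    have "continuous_on (closure D) (\<lambda>z. h (S j z))" if j: "j \<in> J" for j
      using continuous_on_compose2[OF hK _ S(2)[OF j]] S(1)[OF j] by (simp add: in_U_def)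
    then show "continuous_on (closure D) (\<lambda>z. \<Sum>\<^sub>\<infinity>j\<in>J. v j z * h (S j z))"
      using v by (intro continuous_on_infsum[OF _ le sum] continuous_intros) (auto simp: in_U_def)
    have "holomorphic_map (*) (\<lambda>z. v j z * h (S j z)) D" if j: "j \<in> J" for j
    proof (intro holomorphic_map_mult holomorphic_map_compose[OF h])
      show "S j ` D \<subseteq> E" using S(2)[OF j] K(2) closure_subset by blast
    qed (use S(1)[OF j] v[OF j] in \<open>auto simp: in_U_def\<close>)
    moreover have "cmod (v j z * h (S j z)) \<le> c j * M" if "j \<in> J" "z \<in> D" for j z
      using le[OF that(1)] that(2) closure_subset by blast
    ultimately show "holomorphic_map (*) (\<lambda>z. \<Sum>\<^sub>\<infinity>j\<in>J. v j z * h (S j z)) D"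
      by (intro holomorphic_map_infsum[OF _ \<open>open D\<close> _ sum]) auto
  qed
qed

section \<open>Words and their weights\<close>

text \<open>The product of the weights along the orbit of \<open>z\<close>. The first letter acts
  first, as in \<open>fold T\<close>, so that an iterate of the transfer operator becomes a sum over
  words.\<close>

primrec word_weight :: "('i \<Rightarrow> 'a \<Rightarrow> 'a) \<Rightarrow> ('i \<Rightarrow> 'a \<Rightarrow> complex) \<Rightarrow> 'i list \<Rightarrow> 'a \<Rightarrow> complex" where
  "word_weight T w [] z = 1"
| "word_weight T w (i # is) z = w i z * word_weight T w is (T i z)"

definition words :: "'i set \<Rightarrow> nat \<Rightarrow> 'i list set" where
  "words I n = {is. length is = n \<and> set is \<subseteq> I}"

lemma words_0 [simp]: "words I 0 = {[]}"
  by (auto simp: words_def)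

lemma bij_betw_words_Suc: "bij_betw (\<lambda>(i, is). i # is) (I \<times> words I n) (words I (Suc n))"
  by (rule bij_betwI[where g = "\<lambda>is. (hd is, tl is)"])
     (auto simp: words_def length_Suc_conv)

text \<open>The sum over words of length \<open>n\<close> factorises as the \<open>n\<close>-th
  power of the sum of \<open>b\<close>; splitting off the first letter, nonnegativity gives
  summability on the product set.\<close>

lemma prod_list_summable_on_words:
  fixes b :: "'i \<Rightarrow> real"
  assumes "b summable_on I" "\<And>i. i \<in> I \<Longrightarrow> 0 \<le> b i"
  shows "(\<lambda>is. prod_list (map b is)) summable_on words I n"
proof (induction n)
  case (Suc n)
  have "(\<lambda>(i, is). b i * prod_list (map b is)) summable_on I \<times> words I n"
  proof (rule summable_on_SigmaI)
    show "((\<lambda>is. case (i, is) of (i, is) \<Rightarrow> b i * prod_list (map b is)) has_sum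
        b i * infsum (\<lambda>is. prod_list (map b is)) (words I n)) (words I n)" for i
      using Suc by (auto intro!: has_sum_cmult_right)
    show "(\<lambda>i. b i * infsum (\<lambda>is. prod_list (map b is)) (words I n)) summable_on I"
      using assms(1) by (rule summable_on_cmult_left)
    show "0 \<le> (case (i, is) of (i, is) \<Rightarrow> b i * prod_list (map b is))" if "i \<in> I" "is \<in> words I n" for i "is"
      using that assms(2) by (fastforce simp: words_def intro!: mult_nonneg_nonneg prod_list_nonneg)
  qed
  then have "(\<lambda>x. prod_list (map b ((\<lambda>(i, is). i # is) x))) summable_on I \<times> words I n"
    by (simp add: case_prod_unfold)
  then show ?case
    by (simp add: summable_on_reindex_bij_betw[OF bij_betw_words_Suc, of "\<lambda>is. prod_list (map b is)"])
qed simp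

text \<open>Here \<open>T\<close> and \<open>w\<close> stand for the extensions to \<open>D\<close>,
  not for germs along \<open>X\<close>.\<close>

locale map_weight_system =
  fixes X D :: "(complex ^ 'd) set" and I :: "'i set"
    and T :: "'i \<Rightarrow> complex ^ 'd \<Rightarrow> complex ^ 'd" and w :: "'i \<Rightarrow> complex ^ 'd \<Rightarrow> complex"
  assumes D: "bounded_domain D" and X: "compact X" "X \<noteq> {}" "X \<subseteq> D"
    and T_X: "\<And>i x. i \<in> I \<Longrightarrow> x \<in> X \<Longrightarrow> T i x \<in> X"
    and map_system: "holomorphic_map_system D I T"
    and weight_system: "holomorphic_weight_system D I w"
begin

lemma domain: "open D" "connected D" "bounded D" "D \<noteq> {}"
  using D by (auto simp: bounded_domain_def)

text \<open>The compact core of \<open>D\<close>: after a single letter every point of the closure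
  of \<open>D\<close> lies in \<open>K\<close>, so the transfer operator reads its argument
  there.\<close>

definition K where "K = closure (\<Union>i\<in>I. T i ` D)"

lemma K_subset: "K \<subseteq> D"
  using map_system by (simp add: K_def holomorphic_map_system_def compactly_inside_def)

lemma compact_K: "compact K"
proof -
  have "(\<Union>i\<in>I. T i ` D) \<subseteq> D"
    using K_subset closure_subset unfolding K_def by (rule order_trans[rotated])
  then show ?thesis
    unfolding K_def compact_closure using domain(3) by (rule bounded_subset[rotated])
qed

lemma T_in_U: "i \<in> I \<Longrightarrow> in_U (*s) D (T i)"
  using map_system by (simp add: holomorphic_map_system_def)

lemma w_in_U: "i \<in> I \<Longrightarrow> in_U (*) D (w i)"
  using weight_system by (simp add: holomorphic_weight_system_def)

lemma T_closure: "i \<in> I \<Longrightarrow> T i ` closure D \<subseteq> K"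
  by (rule image_closure_subset)
     (use T_in_U closure_subset in \<open>fastforce simp: in_U_def K_def\<close>)+

lemma T_in_K: "i \<in> I \<Longrightarrow> z \<in> closure D \<Longrightarrow> T i z \<in> K"
  using T_closure by blast

lemma T_in_D: "i \<in> I \<Longrightarrow> z \<in> closure D \<Longrightarrow> T i z \<in> D"
  using T_in_K K_subset by blast

lemma w_le: "i \<in> I \<Longrightarrow> z \<in> closure D \<Longrightarrow> cmod (w i z) \<le> U_norm D (w i)"
  using w_in_U domain by (simp add: norm_le_U_norm in_U_def)

lemma U_norm_w_nonneg: "i \<in> I \<Longrightarrow> 0 \<le> U_norm D (w i)"
  using w_le domain(4) closure_subset by (meson all_not_in_conv norm_ge_zero order_trans subsetD)

lemma summable_w: "(\<lambda>i. U_norm D (w i)) summable_on I"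
  using weight_system by (simp add: holomorphic_weight_system_def)

text \<open>The empty word is the identity and need not send the closure of \<open>D\<close> into
  \<open>K\<close>. Invariance of \<open>K\<close> is therefore carried along: it handles the tail,
  possibly empty, once the first letter has reached \<open>K\<close>.\<close>

lemma words_in_U:
  assumes "set is \<subseteq> I"
  shows "in_U (*s) D (fold T is)" "in_U (*) D (word_weight T w is)"
    "z \<in> closure D \<Longrightarrow> cmod (word_weight T w is z) \<le> prod_list (map (\<lambda>i. U_norm D (w i)) is)"
    "z \<in> D \<Longrightarrow> fold T is z \<in> D" "z \<in> X \<Longrightarrow> fold T is z \<in> X"
    "z \<in> closure D \<Longrightarrow> is \<noteq> [] \<Longrightarrow> fold T is z \<in> K" "z \<in> K \<Longrightarrow> fold T is z \<in> K"
proof -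
  have "in_U (*s) D (fold T is) \<and> in_U (*) D (word_weight T w is)
    \<and> (\<forall>z\<in>closure D. cmod (word_weight T w is z) \<le> prod_list (map (\<lambda>i. U_norm D (w i)) is))
    \<and> (\<forall>z\<in>D. fold T is z \<in> D) \<and> (\<forall>z\<in>X. fold T is z \<in> X)
    \<and> (\<forall>z\<in>closure D. is \<noteq> [] \<longrightarrow> fold T is z \<in> K) \<and> (\<forall>z\<in>K. fold T is z \<in> K)"
    using assms
  proof (induction "is")
    case Nil
    have "fold T [] = (\<lambda>z. z)" "word_weight T w [] = (\<lambda>z. 1)" by (auto simp: fun_eq_iff)
    then show ?case
      by (simp add: in_U_def holomorphic_map_id[folded id_def] holomorphic_map_const)
  next
    case (Cons i "is")
    then have i: "i \<in> I" by simp
    have eq: "fold T (i # is) = (\<lambda>z. fold T is (T i z))"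
      "word_weight T w (i # is) = (\<lambda>z. w i z * word_weight T w is (T i z))" by (auto simp: fun_eq_iff)
    have IH: "in_U (*s) D (fold T is)" "in_U (*) D (word_weight T w is)"
      "\<And>z. z \<in> closure D \<Longrightarrow> cmod (word_weight T w is z) \<le> prod_list (map (\<lambda>i. U_norm D (w i)) is)"
      "\<And>z. z \<in> D \<Longrightarrow> fold T is z \<in> D" "\<And>z. z \<in> X \<Longrightarrow> fold T is z \<in> X"
      "\<And>z. z \<in> K \<Longrightarrow> fold T is z \<in> K"
      using Cons by auto
    have T: "continuous_on (closure D) (T i)" "holomorphic_map (*s) (T i) D" "T i ` D \<subseteq> D"
        "T i ` closure D \<subseteq> closure D"
      using T_in_U[OF i] T_in_D[OF i] closure_subset by (auto simp: in_U_def)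
    have "in_U (*s) D (fold T (i # is))"
      using IH(1) T unfolding eq in_U_def
      by (auto intro: continuous_on_compose2 holomorphic_map_compose)
    moreover have "in_U (*) D (word_weight T w (i # is))"
      using IH(2) T w_in_U[OF i] unfolding eq in_U_def
      by (auto intro!: continuous_on_mult holomorphic_map_mult
          intro: continuous_on_compose2 holomorphic_map_compose)
    moreover have "cmod (word_weight T w (i # is) z) \<le> prod_list (map (\<lambda>i. U_norm D (w i)) (i # is))"
      if "z \<in> closure D" for z
      using mult_mono[OF w_le[OF i that] IH(3)[of "T i z"]] T(4) that U_norm_w_nonneg[OF i]
      by (auto simp: norm_mult)
    moreover have "fold T (i # is) z \<in> D" if "z \<in> D" for z
      using IH(4) T(3) that by auto
    moreover have "fold T (i # is) z \<in> X" if "z \<in> X" for z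
      using IH(5) T_X[OF i] that by auto
    moreover have K: "fold T (i # is) z \<in> K" if "z \<in> closure D" for z
      using IH(6) T_in_K[OF i that] by auto
    moreover have "fold T (i # is) z \<in> K" if "z \<in> K" for z
      by (rule K) (use K_subset closure_subset that in blast)
    ultimately show ?case by (intro conjI ballI impI)
  qed
  then show "in_U (*s) D (fold T is)" "in_U (*) D (word_weight T w is)"
    "z \<in> closure D \<Longrightarrow> cmod (word_weight T w is z) \<le> prod_list (map (\<lambda>i. U_norm D (w i)) is)"
    "z \<in> D \<Longrightarrow> fold T is z \<in> D" "z \<in> X \<Longrightarrow> fold T is z \<in> X"
    "z \<in> closure D \<Longrightarrow> is \<noteq> [] \<Longrightarrow> fold T is z \<in> K" "z \<in> K \<Longrightarrow> fold T is z \<in> K"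
    by auto
qed

lemma summable_word_norms:
  "(\<lambda>is. prod_list (map (\<lambda>i. U_norm D (w i)) is)) summable_on words I n"
  by (rule prod_list_summable_on_words[OF summable_w U_norm_w_nonneg])

text \<open>Fubini over the first letter and the tail. Both choices of \<open>S\<close> are covered
  since \<open>T i z\<close> lies in \<open>D\<close>, where the cut-off in
  \<open>transfer_operator\<close> is invisible. Summability is checked on nonempty words, which
  send \<open>z\<close> into \<open>K\<close>, where \<open>h\<close> is bounded.\<close>

lemma transfer_operator_iterate:
  assumes S: "D \<subseteq> S" "S \<subseteq> closure D" and h: "continuous_on D h" and z: "z \<in> S"
  shows "(transfer_operator S I T w ^^ n) h z
    = (\<Sum>\<^sub>\<infinity>is\<in>words I n. word_weight T w is z * h (fold T is z))"
  using z
proof (induction n arbitrary: z)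
  case (Suc n)
  obtain M where M: "\<And>x. x \<in> K \<Longrightarrow> cmod (h x) \<le> M"
    using compact_continuous_image[OF continuous_on_subset[OF h K_subset] compact_K] compact_imp_bounded
    by (metis bounded_iff imageI)
  let ?F = "\<lambda>is. word_weight T w is z * h (fold T is z)"
  have zc: "z \<in> closure D" using Suc.prems S by blast
  have "(transfer_operator S I T w ^^ Suc n) h z
      = (\<Sum>\<^sub>\<infinity>i\<in>I. w i z * (transfer_operator S I T w ^^ n) h (T i z))"
    using Suc.prems by (simp add: transfer_operator_def restrict_zero_def)
  also have "\<dots> = (\<Sum>\<^sub>\<infinity>i\<in>I. \<Sum>\<^sub>\<infinity>is\<in>words I n. ?F (i # is))"
  proof (rule infsum_cong)
    fix i assume i: "i \<in> I"
    have "T i z \<in> S" using T_in_D[OF i zc] S by blast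
    from Suc.IH[OF this] show "w i z * (transfer_operator S I T w ^^ n) h (T i z)
        = (\<Sum>\<^sub>\<infinity>is\<in>words I n. ?F (i # is))"
      by (simp add: mult.assoc infsum_cmult_right')
  qed
  also have "\<dots> = (\<Sum>\<^sub>\<infinity>(i, is)\<in>I \<times> words I n. ?F (i # is))"
  proof (rule infsum_Sigma'_banach)
    have "cmod (?F is) \<le> prod_list (map (\<lambda>i. U_norm D (w i)) is) * M" if "is \<in> words I (Suc n)" for "is"
    proof -
      have *: "set is \<subseteq> I" "is \<noteq> []" using that by (auto simp: words_def)
      show ?thesis
        using mult_mono[OF words_in_U(3)[OF *(1) zc] M[OF words_in_U(6)[OF *(1) zc *(2)]]]
          words_in_U(3)[OF *(1) zc] by (simp add: norm_mult) (meson norm_ge_zero order_trans)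
    qed
    from abs_summable_bound(2)[OF summable_on_cmult_left[OF summable_word_norms] this]
    have "?F summable_on words I (Suc n)" .
    then show "(\<lambda>(i, is). ?F (i # is)) summable_on I \<times> words I n"
      using summable_on_reindex_bij_betw[OF bij_betw_words_Suc, of ?F I n] by (simp add: case_prod_unfold)
  qed
  also have "\<dots> = infsum ?F (words I (Suc n))"
    using infsum_reindex_bij_betw[OF bij_betw_words_Suc, of ?F I n] by (simp add: case_prod_unfold)
  finally show ?case .
qed (simp)

text \<open>The mechanism of the Earle--Hamilton theorem: replacing \<open>T i\<close> by
  \<open>x \<mapsto> T i x + t (T i x - T i p)\<close>, which still maps \<open>D\<close> into itself for small \<open>t\<close>, multiplies the
  derivative at \<open>p\<close> by \<open>1 + t\<close>, so each map of the system contracts a Cauchy-type bound by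
  \<open>1 / (1 + t)\<close>.\<close>

lemma word_derivative_bound:
  obtains q where "0 < q" "q < 1"
    "\<And>is h z r F v. \<lbrakk>set is \<subseteq> I; holomorphic_map (*) h D; \<And>x. x \<in> D \<Longrightarrow> cmod (h x) \<le> 1; 0 < r; cball z r \<subseteq> D;
      ((\<lambda>x. h (fold T is x)) has_derivative F) (at z)\<rbrakk> \<Longrightarrow> cmod (F v) \<le> q ^ length is * (norm v / r)"
proof -
  obtain e where e: "e > 0" "(\<Union>x\<in>K. ball x e) \<subseteq> D"
    using compact_subset_open_imp_ball_epsilon_subset[OF compact_K domain(1) K_subset] by blast
  obtain B where B: "B > 0" "\<And>x. x \<in> D \<Longrightarrow> norm x \<le> B"
    using domain(3) bounded_pos by metis
  \<comment> \<open>Makes the perturbation at most \<open>t * (2 * B) = e / 2\<close> in norm, so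
    the perturbed map stays in the \<open>e\<close>-neighbourhood of \<open>K\<close>, inside
    \<open>D\<close>.\<close>
  define t where "t = e / (4 * B)"
  have t: "t > 0" using e B by (simp add: t_def)
  have "cmod (F v) \<le> (1 / (1 + t)) ^ length is * (norm v / r)"
    if "set is \<subseteq> I" "holomorphic_map (*) h D" "\<And>x. x \<in> D \<Longrightarrow> cmod (h x) \<le> 1" "0 < r" "cball z r \<subseteq> D"
      "((\<lambda>x. h (fold T is x)) has_derivative F) (at z)" for "is" h z r F v
    using that
  \<comment> \<open>The last letter is absorbed into the test function: \<open>h\<close> composed
    with \<open>G\<close> is again holomorphic on \<open>D\<close> and bounded by 1. Hence letters
    are removed from the end and \<open>h\<close> is arbitrary.\<close>
  proof (induction "is" arbitrary: h F rule: rev_induct)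
    case Nil
    have z: "z \<in> D" using Nil by auto
    obtain f' where f': "(h has_derivative f') (at z)" "\<And>c v. f' (c *s v) = c * f' v"
      using holomorphic_mapE[OF Nil(2) z] by blast
    have "f' = F" using f'(1) Nil(6) has_derivative_unique by auto
    then show ?case
      using Cauchy_derivative_bound[OF Nil(2,5,4) _ f', of 1 v] Nil(3,5) by (auto simp: subset_iff)
  next
    case (snoc i "is")
    have i: "i \<in> I" and "is": "set is \<subseteq> I" and z: "z \<in> D" using snoc.prems by auto
    define p where "p = fold T is z"
    have p: "p \<in> D" unfolding p_def using words_in_U(4)[OF "is" z] .
    define G where "G x = T i x + of_real t *s (T i x + - T i p)" for x
    have Tp: "T i x \<in> K" "norm (T i x) \<le> B" if "x \<in> D" for x
      using T_in_K[OF i] T_in_D[OF i] B closure_subset that by blast+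
    have G_D: "G ` D \<subseteq> D"
    proof
      fix y assume "y \<in> G ` D"
      then obtain x where x: "x \<in> D" "y = G x" by blast
      have "norm (T i x + - T i p) \<le> 2 * B"
        using Tp(2)[OF x(1)] Tp(2)[OF p] norm_triangle_ineq4[of "T i x" "T i p"] by simp
      then have "norm (of_real t *s (T i x + - T i p)) \<le> t * (2 * B)"
        unfolding norm_vector_smult using t mult_left_mono by fastforce
      also have "\<dots> < e" using e B by (simp add: t_def)
      finally have "y \<in> ball (T i x) e"
        unfolding x(2) G_def mem_ball
        by (subst dist_commute) (simp only: dist_norm add_diff_cancel_left')
      then show "y \<in> D" using e Tp(1)[OF x(1)] by blast
    qed
    have T_hol: "holomorphic_map (*s) (T i) D" using T_in_U[OF i] by (simp add: in_U_def)
    have G_hol: "holomorphic_map (*s) G D"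
      unfolding G_def by (intro holomorphic_map_add holomorphic_map_smult T_hol holomorphic_map_const_vec)
        (auto simp: vec_eq_iff algebra_simps)
    obtain g' where g': "(fold T is has_derivative g') (at z)"
      using words_in_U(1)[OF "is"] z by (meson holomorphic_mapE in_U_def)
    obtain A where A: "(T i has_derivative A) (at p)" "\<And>c v. A (c *s v) = c *s A v"
      using holomorphic_mapE[OF T_hol p] by blast
    obtain H where H: "(h has_derivative H) (at (T i p))" "\<And>c v. H (c *s v) = c * H v"
      using holomorphic_mapE[OF snoc.prems(2), of "T i p"] T_in_D[OF i] p closure_subset by blast
    have blin: "bounded_linear (\<lambda>v::complex ^ 'd. of_real t *s v)"
      by (rule bounded_linear_intro[where K = "cmod (of_real t)"])
         (auto simp: norm_vector_smult vec_eq_iff algebra_simps)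
    have "((\<lambda>x. T i x + - T i p) has_derivative A) (at p)"
      using has_derivative_add[OF A(1) has_derivative_const, of "- T i p"] by simp
    from has_derivative_add[OF A(1) bounded_linear.has_derivative[OF blin this]]
    have "(G has_derivative (\<lambda>v. A v + of_real t *s A v)) (at p)" by (simp add: G_def[abs_def])
    from has_derivative_compose[OF g' this[unfolded p_def]]
    have "((\<lambda>x. G (fold T is x)) has_derivative (\<lambda>v. A (g' v) + of_real t *s A (g' v))) (at z)" .
    from has_derivative_compose[OF this, of h H] H(1)
    have "((\<lambda>x. h (G (fold T is x))) has_derivative (\<lambda>v. H (A (g' v) + of_real t *s A (g' v)))) (at z)"
      by (simp add: G_def p_def)
    moreover have "H (A (g' v) + of_real t *s A (g' v)) = of_real (1 + t) * H (A (g' v))" for v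
      using linear_add[OF has_derivative_linear[OF H(1)]] H(2) by (simp add: algebra_simps)
    ultimately have D1: "((\<lambda>x. h (G (fold T is x))) has_derivative (\<lambda>v. of_real (1 + t) * H (A (g' v)))) (at z)"
      by simp
    \<comment> \<open>With \<open>G\<close> in place of \<open>T i\<close> the derivative is
      \<open>1 + t\<close> times the wanted one and still obeys the bound for the shorter word;
      dividing gains one factor.\<close>
    have le: "cmod (of_real (1 + t) * H (A (g' v))) \<le> (1 / (1 + t)) ^ length is * (norm v / r)"
    proof (rule snoc.IH[OF "is" _ _ _ _ D1])
      show "holomorphic_map (*) (\<lambda>x. h (G x)) D"
        by (rule holomorphic_map_compose[OF snoc.prems(2) G_hol G_D])
      show "cmod (h (G x)) \<le> 1" if "x \<in> D" for x
        using snoc.prems(3) G_D that by blast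
    qed (use snoc.prems in auto)
    have "((\<lambda>x. h (fold T (is @ [i]) x)) has_derivative (\<lambda>v. H (A (g' v)))) (at z)"
      using has_derivative_compose[OF has_derivative_compose[OF g' A(1)[unfolded p_def]] H(1)[unfolded p_def]]
      by simp
    then have "F = (\<lambda>v. H (A (g' v)))" using snoc.prems(6) has_derivative_unique by blast
    moreover have "cmod (H (A (g' v))) = 1 / (1 + t) * cmod (of_real (1 + t) * H (A (g' v)))"
      unfolding norm_mult norm_of_real using t by simp
    moreover have "\<dots> \<le> 1 / (1 + t) * ((1 / (1 + t)) ^ length is * (norm v / r))"
      using le t by (intro mult_left_mono) auto
    ultimately show ?case by simp
  qed
  then show ?thesis using t by (intro that[of "1 / (1 + t)"]) auto
qed

text \<open>Distances are recovered from scalar test functions by taking coordinates. Over a ball of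
  radius \<open>r\<close>, the mean value estimate cancels the \<open>r\<close> in the derivative
  bound.\<close>

lemma word_Lipschitz:
  obtains q where "0 < q" "q < 1"
    "\<And>y r. 0 < r \<Longrightarrow> cball y (2 * r) \<subseteq> D \<Longrightarrow> \<exists>C\<ge>0. \<forall>is a b. set is \<subseteq> I \<longrightarrow> a \<in> cball y r \<longrightarrow> b \<in> cball y r \<longrightarrow>
       dist (fold T is a) (fold T is b) \<le> C * q ^ length is"
proof -
  obtain q where q: "0 < q" "q < 1"
    and bound: "\<And>is h z r F v. \<lbrakk>set is \<subseteq> I; holomorphic_map (*) h D; \<And>x. x \<in> D \<Longrightarrow> cmod (h x) \<le> 1; 0 < r;
      cball z r \<subseteq> D; ((\<lambda>x. h (fold T is x)) has_derivative F) (at z)\<rbrakk>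
      \<Longrightarrow> cmod (F v) \<le> q ^ length is * (norm v / r)"
    using word_derivative_bound by blast
  obtain b where b: "b > 0" "\<And>x. x \<in> D \<Longrightarrow> norm x \<le> b"
    using domain(3) bounded_pos by metis
  have "dist (fold T is x) (fold T is y) \<le> CARD('d) * (2 * b) * q ^ length is"
    if r: "0 < r" "cball c (2 * r) \<subseteq> D" and "is": "set is \<subseteq> I" and x: "x \<in> cball c r" and y: "y \<in> cball c r"
    for c r "is" x y
  proof -
    have comp: "cmod (fold T is x $ k - fold T is y $ k) \<le> 2 * b * q ^ length is" for k
    proof -
      \<comment> \<open>The coordinate is scaled by the bound \<open>b\<close> of \<open>D\<close>,
        so that its modulus is at most 1 on \<open>D\<close>.\<close>
      define h where "h z = (1 / of_real b) * z $ k" for z :: "complex ^ 'd"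
      have h: "holomorphic_map (*) h D"
        unfolding h_def by (intro holomorphic_map_mult holomorphic_map_const
            holomorphic_map_component holomorphic_map_id)
      have h1: "cmod (h z) \<le> 1" if "z \<in> D" for z
        using b(1) b(2)[OF that] Finite_Cartesian_Product.norm_nth_le[of z k]
        by (simp add: h_def norm_mult norm_divide divide_simps)
      have hol: "holomorphic_map (*) (\<lambda>z. h (fold T is z)) D"
        using words_in_U(1,4)[OF "is"] by (intro holomorphic_map_compose[OF h]) (auto simp: in_U_def)
      have sub: "cball a r \<subseteq> D" if "a \<in> cball c r" for a
        using that by (intro order_trans[OF _ r(2)]) (simp add: cball_subset_cball_iff dist_commute)
      have "\<forall>a\<in>cball c r. \<exists>F. ((\<lambda>z. h (fold T is z)) has_derivative F) (at a)"
        using holomorphic_map_subset[OF hol order_trans[OF subset_cball r(2)], of r] r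
        by (fastforce simp: holomorphic_map_def)
      then obtain F where F: "\<And>a. a \<in> cball c r \<Longrightarrow> ((\<lambda>z. h (fold T is z)) has_derivative F a) (at a)"
        by metis
      have "cmod (h (fold T is x) - h (fold T is y)) \<le> q ^ length is / r * norm (x - y)"
      proof (rule differentiable_bound[OF convex_cball _ _ x y])
        show "((\<lambda>z. h (fold T is z)) has_derivative F a) (at a within cball c r)" if "a \<in> cball c r" for a
          using F[OF that] has_derivative_at_withinI by blast
        show "onorm (F a) \<le> q ^ length is / r" if "a \<in> cball c r" for a
          using bound[OF "is" h h1 r(1) sub[OF that] F[OF that]] by (intro onorm_le) simp
      qed
      also have "\<dots> \<le> q ^ length is / r * (2 * r)"
        using x y r q norm_triangle_ineq4[of "x - c" "y - c"]
        by (intro mult_left_mono) (auto simp: dist_norm norm_minus_commute)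
      also have "\<dots> = 2 * q ^ length is" using r by simp
      finally have "cmod (1 / of_real b * (fold T is x $ k - fold T is y $ k)) \<le> 2 * q ^ length is"
        by (simp add: h_def algebra_simps)
      then show ?thesis using b(1) by (simp add: norm_mult norm_divide field_simps)
    qed
    have "dist (fold T is x) (fold T is y) \<le> (\<Sum>k\<in>UNIV. cmod ((fold T is x - fold T is y) $ k))"
      unfolding dist_norm norm_vec_def by (rule L2_set_le_sum) simp
    also have "\<dots> \<le> (\<Sum>k\<in>(UNIV :: 'd set). 2 * b * q ^ length is)"
      by (intro sum_mono) (use comp in simp)
    finally show ?thesis by (simp add: mult.assoc)
  qed
  then show ?thesis using b(1) q
    by (intro that[of q] exI[of _ "CARD('d) * (2 * b)"] conjI allI impI) auto
qed

text \<open>Words contract geometrically near each point, so orbits of neighbouring points merge;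
  connectedness of \<open>D\<close> spreads this to all pairs of points, and compactness of
  \<open>K\<close> makes it uniform. The comparison is with an orbit that starts, and hence stays,
  in \<open>X\<close>.\<close>

lemma words_approach_X:
  assumes "0 < e"
  obtains m where "\<And>is z. set is \<subseteq> I \<Longrightarrow> m \<le> length is \<Longrightarrow> z \<in> closure D \<Longrightarrow> \<exists>x\<in>X. dist x (fold T is z) < e"
proof -
  obtain q where q: "0 < q" "q < 1" and Lip:
    "\<And>y r. 0 < r \<Longrightarrow> cball y (2 * r) \<subseteq> D \<Longrightarrow> \<exists>C\<ge>0. \<forall>is a b. set is \<subseteq> I \<longrightarrow> a \<in> cball y r \<longrightarrow> b \<in> cball y r \<longrightarrow>
       dist (fold T is a) (fold T is b) \<le> C * q ^ length is"
    using word_Lipschitz by blast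
  define close where "close e m a b \<longleftrightarrow>
    (\<forall>is. set is \<subseteq> I \<longrightarrow> m \<le> length is \<longrightarrow> dist (fold T is a) (fold T is b) < e)" for e m a b
  have close_trans: "close e (max m n) a c" if "close (e / 2) m a b" "close (e / 2) n b c" for e m n a b c
    unfolding close_def
  proof (intro allI impI)
    fix "is" assume "set is \<subseteq> I" "max m n \<le> length is"
    then have "dist (fold T is a) (fold T is b) < e / 2" "dist (fold T is b) (fold T is c) < e / 2"
      using that unfolding close_def by auto
    then show "dist (fold T is a) (fold T is c) < e"
      using dist_triangle[of "fold T is a" "fold T is c" "fold T is b"] by linarith
  qed
  have close_sym: "close e m a b \<Longrightarrow> close e m b a" for e m a b
    by (simp add: close_def dist_commute)
  have loc: "\<exists>r>0. ball a r \<subseteq> D \<and> (\<forall>e>0. \<exists>m. \<forall>b\<in>ball a r. close e m a b)" if a: "a \<in> D" for a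
  proof -
    obtain R where R: "R > 0" "cball a R \<subseteq> D" using a domain(1) open_contains_cball by blast
    then obtain C where C: "C \<ge> 0" "\<And>is b. set is \<subseteq> I \<Longrightarrow> b \<in> cball a (R / 2) \<Longrightarrow>
        dist (fold T is a) (fold T is b) \<le> C * q ^ length is"
      using Lip[of "R / 2" a] by force
    have "\<exists>m. \<forall>b\<in>ball a (R / 2). close e m a b" if e: "e > 0" for e
    proof -
      have "(\<lambda>n. C * q ^ n) \<longlonglongrightarrow> C * 0"
        by (intro tendsto_mult tendsto_const LIMSEQ_realpow_zero) (use q in auto)
      from order_tendstoD(2)[OF this, of e]
      obtain m where m: "\<And>n. n \<ge> m \<Longrightarrow> C * q ^ n < e"
        using e by (auto simp: eventually_sequentially)
      have "close e m a b" if "b \<in> ball a (R / 2)" for b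
        unfolding close_def
      proof (intro allI impI)
        fix "is" assume "set is \<subseteq> I" "m \<le> length is"
        then show "dist (fold T is a) (fold T is b) < e"
          using C(2)[of "is" b] m[of "length is"] that by simp
      qed
      then show ?thesis by blast
    qed
    moreover have "ball a (R / 2) \<subseteq> D" using R by (auto simp: subset_iff)
    ultimately show ?thesis using R by (intro exI[of _ "R / 2"]) auto
  qed
  obtain x0 where x0: "x0 \<in> X" using X by blast
  \<comment> \<open>Merging, that is \<open>\<forall>e>0. \<exists>m. close e m x y\<close>, is an
    equivalence relation with open classes in the connected set \<open>D\<close>, so there is just
    one class.\<close>
  have conv: "\<forall>e>0. \<exists>m. close e m x0 a" if a: "a \<in> D" for a
  proof (rule connected_equivalence_relation[OF domain(2) _ a, of x0 "\<lambda>x y. \<forall>e>0. \<exists>m. close e m x y"])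
    show "x0 \<in> D" using x0 X by blast
    show "\<forall>e>0. \<exists>m. close e m y x" if "\<forall>e>0. \<exists>m. close e m x y" for x y
      using that close_sym by blast
    show "\<forall>e>0. \<exists>m. close e m x z" if "\<forall>e>0. \<exists>m. close e m x y" "\<forall>e>0. \<exists>m. close e m y z" for x y z
      using that close_trans half_gt_zero by metis
    show "\<exists>U. openin (top_of_set D) U \<and> a \<in> U \<and> (\<forall>x\<in>U. \<forall>e>0. \<exists>m. close e m a x)" if "a \<in> D" for a
      using loc[OF that] by (metis centre_in_ball open_ball open_subset)
  qed
  have "\<forall>a\<in>K. \<exists>r>0. \<exists>m. \<forall>b\<in>ball a r. close e m x0 b"
  proof
    fix a assume "a \<in> K"
    then have a: "a \<in> D" using K_subset by blast
    obtain m where m: "close (e / 2) m x0 a" using conv[OF a] assms half_gt_zero by blast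
    obtain r n where rn: "r > 0" "\<forall>b\<in>ball a r. close (e / 2) n a b"
      using loc[OF a] assms half_gt_zero by metis
    show "\<exists>r>0. \<exists>m. \<forall>b\<in>ball a r. close e m x0 b"
      using close_trans[OF m] rn by blast
  qed
  then obtain r m where rm: "\<And>a. a \<in> K \<Longrightarrow> r a > 0" "\<And>a b. a \<in> K \<Longrightarrow> b \<in> ball a (r a) \<Longrightarrow> close e (m a) x0 b"
    by metis
  have "K \<subseteq> (\<Union>a\<in>K. ball a (r a))" using rm(1) by auto
  then obtain F where F: "F \<subseteq> K" "finite F" "K \<subseteq> (\<Union>a\<in>F. ball a (r a))"
    using compactE_image[OF compact_K, of K "\<lambda>a. ball a (r a)"] by auto
  \<comment> \<open>\<open>Suc\<close> pays for the first letter, which takes the closure of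
    \<open>D\<close> into \<open>K\<close>; \<open>insert 0\<close> covers an empty
    \<open>F\<close>.\<close>
  define M where "M = Suc (Max (insert 0 (m ` F)))"
  show ?thesis
  proof (rule that)
    fix "is" z assume "is": "set is \<subseteq> I" "M \<le> length is" and z: "z \<in> closure D"
    then obtain i js where ijs: "is = i # js" by (cases "is") (auto simp: M_def)
    have i: "i \<in> I" and js: "set js \<subseteq> I" using "is" ijs by auto
    obtain a where a: "a \<in> F" "T i z \<in> ball a (r a)" using F T_in_K[OF i z] by blast
    have "m a \<le> Max (insert 0 (m ` F))" using a F by (intro Max_ge) auto
    then have "m a \<le> length js" using "is" ijs by (simp add: M_def)
    then have "dist (fold T js x0) (fold T js (T i z)) < e"
      using rm(2)[of a "T i z"] a F js unfolding close_def by blast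
    then show "\<exists>x\<in>X. dist x (fold T is z) < e"
      using words_in_U(5)[OF js x0] by (auto simp: ijs)
  qed
qed

text \<open>All \<open>T i\<close> are bounded by the same \<open>b\<close> on \<open>D\<close>, so
  Cauchy's estimate gives them a common Lipschitz constant near \<open>X\<close>. Uniformity in
  \<open>i\<close> matters because \<open>I\<close> may be infinite.\<close>

lemma T_equicontinuous_at_X:
  assumes "0 < e"
  obtains \<rho> where "0 < \<rho>" "\<And>i x z. i \<in> I \<Longrightarrow> x \<in> X \<Longrightarrow> dist x z < \<rho> \<Longrightarrow> dist (T i x) (T i z) < e"
proof -
  obtain R where R: "R > 0" "(\<Union>x\<in>X. ball x R) \<subseteq> D"
    using compact_subset_open_imp_ball_epsilon_subset[OF X(1) domain(1) X(3)] by blast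
  obtain b where b: "b > 0" "\<And>x. x \<in> D \<Longrightarrow> norm x \<le> b"
    using domain(3) bounded_pos by metis
  define r where "r = R / 4"
  have r: "r > 0" using R by (simp add: r_def)
  define L where "L = CARD('d) * (b / r)"
  have L: "L > 0" using b r by (simp add: L_def)
  show ?thesis
  proof (rule that[of "min r (e / L)"])
    show "0 < min r (e / L)" using r L assms by simp
    fix i x z assume i: "i \<in> I" and x: "x \<in> X" and z: "dist x z < min r (e / L)"
    have sub: "cball x (2 * r) \<subseteq> D" using R x by (force simp: r_def)
    have "norm (T i x - T i z) \<le> L * norm (x - z)"
      unfolding L_def
    proof (rule holomorphic_map_Lipschitz_vec[OF _ sub r])
      show "holomorphic_map (*s) (T i) D" using T_in_U[OF i] by (simp add: in_U_def)
      show "norm (T i y) \<le> b" if "y \<in> cball x (2 * r)" for y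
        using T_in_D[OF i] that sub closure_subset b(2) by blast
    qed (use z r in auto)
    also have "\<dots> < e" using z L by (simp add: dist_norm field_simps)
    finally show "dist (T i x) (T i z) < e" by (simp add: dist_norm)
  qed
qed

end

section \<open>Transfer operators and their generalized eigenspaces\<close>

text \<open>Covers both \<open>U(D)\<close>, with \<open>S\<close> the closure of \<open>D\<close>, and the favourable spaces, with \<open>S = D\<close>.\<close>

locale transfer_space = map_weight_system X D I T w
  for X D :: "(complex ^ 'd) set" and I :: "'i set"
    and T :: "'i \<Rightarrow> complex ^ 'd \<Rightarrow> complex ^ 'd" and w :: "'i \<Rightarrow> complex ^ 'd \<Rightarrow> complex" +
  fixes S :: "(complex ^ 'd) set" and B :: "(complex ^ 'd \<Rightarrow> complex) set"
  assumes S: "D \<subseteq> S" "S \<subseteq> closure D"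
    and subspace_B: "cfun.subspace B"
    and B_hol: "\<And>f. f \<in> B \<Longrightarrow> holomorphic_map (*) f D"
    and B_zero: "\<And>f. f \<in> B \<Longrightarrow> (\<And>z. z \<in> D \<Longrightarrow> f z = 0) \<Longrightarrow> f = 0"
    and B_contains: "\<And>f. in_U (*) D f \<Longrightarrow> restrict_zero S f \<in> B"
begin

abbreviation L where "L \<equiv> transfer_operator S I T w"
abbreviation shift where "shift \<mu> \<equiv> \<lambda>g. L g - (\<lambda>z. \<mu> * g z)"
abbreviation G where "G \<mu> \<equiv> generalized_eigenspace B L \<mu>"

lemma B_add: "f \<in> B \<Longrightarrow> g \<in> B \<Longrightarrow> f + g \<in> B"
  by (rule cfun.subspace_add[OF subspace_B])

lemma B_diff: "f \<in> B \<Longrightarrow> g \<in> B \<Longrightarrow> f - g \<in> B"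
  by (rule cfun.subspace_diff[OF subspace_B])

lemma B_scale: "f \<in> B \<Longrightarrow> (\<lambda>z. c * f z) \<in> B"
  by (rule cfun.subspace_scale[OF subspace_B])

text \<open>\<open>f\<close> enters through its values on the compact \<open>K\<close> inside
  \<open>D\<close>. Whatever its boundary behaviour, the image is therefore of class
  \<open>U(D)\<close>, and so belongs, after restriction, to every space considered here.\<close>

lemma L_in_U:
  assumes "f \<in> B" shows "in_U (*) D (\<lambda>z. \<Sum>\<^sub>\<infinity>i\<in>I. w i z * f (T i z))"
  using domain(1) T_in_U T_closure w_in_U w_le summable_w B_hol[OF assms] compact_K K_subset
  by (rule weighted_composition_in_U)

lemma L_in_B: "f \<in> B \<Longrightarrow> L f \<in> B"
  unfolding transfer_operator_def by (intro B_contains L_in_U)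

lemma L_summable:
  assumes "f \<in> B" "z \<in> closure D"
  shows "(\<lambda>i. w i z * f (T i z)) summable_on I"
proof -
  have "continuous_on K f"
    using holomorphic_map_continuous_on[OF B_hol[OF assms(1)]] K_subset continuous_on_subset by blast
  then obtain M where "\<And>x. x \<in> K \<Longrightarrow> cmod (f x) \<le> M"
    using compact_continuous_image[OF _ compact_K] compact_imp_bounded by (metis bounded_iff imageI)
  then show ?thesis
    using weighted_composition_summable(1)[OF summable_w, of w z f T M] w_le T_in_K assms(2) by blast
qed

lemma L_add: assumes "f \<in> B" "g \<in> B" shows "L (f + g) = L f + L g"
proof
  fix z show "L (f + g) z = (L f + L g) z"
    using L_summable[OF assms(1), of z] L_summable[OF assms(2), of z] S
    by (auto simp: transfer_operator_def restrict_zero_def distrib_left infsum_add)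
qed

lemma L_scale: "L (\<lambda>z. c * f z) = (\<lambda>z. c * L f z)"
  unfolding transfer_operator_def restrict_zero_def fun_eq_iff
  by (auto simp: mult.left_commute[of _ c] infsum_cmult_right')

lemma L_diff: assumes "f \<in> B" "g \<in> B" shows "L (f - g) = L f - L g"
proof -
  have "f - g = f + (\<lambda>z. -1 * g z)" by (simp add: fun_eq_iff)
  then have "L (f - g) = L f + (\<lambda>z. -1 * L g z)"
    using L_add[OF assms(1) B_scale[OF assms(2), of "-1"]] L_scale[of "-1" g] by metis
  then show ?thesis by (simp add: fun_eq_iff)
qed

lemma L_zero: "L 0 = 0"
  by (simp add: transfer_operator_def restrict_zero_def fun_eq_iff)

lemma shift_in_B: "f \<in> B \<Longrightarrow> shift \<mu> f \<in> B"
  by (intro B_diff L_in_B B_scale)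

lemma shift_power_in_B: "f \<in> B \<Longrightarrow> (shift \<mu> ^^ k) f \<in> B"
  by (induction k) (auto intro: shift_in_B)

lemma shift_power_add:
  assumes "f \<in> B" "g \<in> B"
  shows "(shift \<mu> ^^ k) (f + g) = (shift \<mu> ^^ k) f + (shift \<mu> ^^ k) g"
proof (induction k)
  case (Suc k)
  have "shift \<mu> (u + v) = shift \<mu> u + shift \<mu> v" if "u \<in> B" "v \<in> B" for u v
    unfolding L_add[OF that] by (simp add: fun_eq_iff algebra_simps)
  from this[OF shift_power_in_B[OF assms(1)] shift_power_in_B[OF assms(2)]] Suc show ?case
    by (simp only: funpow.simps o_apply)
qed simp

lemma shift_power_scale: "(shift \<mu> ^^ k) (\<lambda>z. c * f z) = (\<lambda>z. c * (shift \<mu> ^^ k) f z)"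
proof (induction k)
  case (Suc k)
  have "shift \<mu> (\<lambda>z. c * u z) = (\<lambda>z. c * shift \<mu> u z)" for u
    unfolding L_scale[of c u] by (rule ext) (simp add: right_diff_distrib mult.left_commute)
  with Suc show ?case by (simp only: funpow.simps o_apply)
qed simp

lemma shift_power_zero: "(shift \<mu> ^^ k) 0 = 0"
  using shift_power_scale[of k \<mu> 0 0] by (simp add: zero_fun_def)

lemma shift_power_mono:
  assumes "(shift \<mu> ^^ k) f = 0" "k \<le> m" shows "(shift \<mu> ^^ m) f = 0"
proof -
  obtain j where "m = j + k" using assms(2) le_iff_add add.commute by metis
  then show ?thesis by (simp only: funpow_add o_apply assms(1) shift_power_zero)
qed

lemma G_subset: "G \<mu> \<subseteq> B"
  by (auto simp: generalized_eigenspace_def)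

lemma GI: "f \<in> B \<Longrightarrow> (shift \<mu> ^^ k) f = 0 \<Longrightarrow> f \<in> G \<mu>"
  by (auto simp: generalized_eigenspace_def)

lemma GE:
  assumes "f \<in> G \<mu>" obtains k where "f \<in> B" "(shift \<mu> ^^ k) f = 0"
  using assms by (auto simp: generalized_eigenspace_def)

lemma subspace_G: "cfun.subspace (G \<mu>)"
  unfolding cfun.subspace_def
proof (intro conjI ballI allI)
  show "0 \<in> G \<mu>"
    by (rule GI[where k = 0, OF cfun.subspace_0[OF subspace_B]]) simp
next
  fix f g assume f: "f \<in> G \<mu>" and g: "g \<in> G \<mu>"
  obtain k where k: "f \<in> B" "(shift \<mu> ^^ k) f = 0" using f by (rule GE)
  obtain m where m: "g \<in> B" "(shift \<mu> ^^ m) g = 0" using g by (rule GE)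
  have "(shift \<mu> ^^ max k m) (f + g) = 0 + 0"
    unfolding shift_power_add[OF k(1) m(1)] shift_power_mono[OF k(2) max.cobounded1]
      shift_power_mono[OF m(2) max.cobounded2] ..
  then show "f + g \<in> G \<mu>" by (intro GI[OF B_add[OF k(1) m(1)]]) (simp only: add_0_left)
next
  fix c f assume "f \<in> G \<mu>"
  then obtain k where k: "f \<in> B" "(shift \<mu> ^^ k) f = 0" by (rule GE)
  have "(shift \<mu> ^^ k) (\<lambda>z. c * f z) = 0"
    unfolding shift_power_scale k(2) by (simp add: fun_eq_iff)
  then show "(\<lambda>z. c * f z) \<in> G \<mu>" by (rule GI[OF B_scale[OF k(1)]])
qed

text \<open>On \<open>G \<mu>\<close> the operator is \<open>\<mu>\<close> plus a locally nilpotent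
  part. If \<open>L q = shift \<mu> f\<close>, then \<open>L (f - q)\<close> is \<open>\<mu>\<close>
  times \<open>f\<close>, so dividing \<open>f - q\<close> by \<open>\<mu>\<close> gives a preimage;
  such a \<open>q\<close> exists by induction on the order of nilpotency. This goes element by
  element, before finite dimension is known.\<close>

lemma L_surj_G:
  assumes "\<mu> \<noteq> 0" "f \<in> G \<mu>"
  shows "\<exists>p\<in>G \<mu>. L p = f"
proof -
  have "\<exists>p\<in>G \<mu>. L p = f" if "f \<in> B" "(shift \<mu> ^^ k) f = 0" for k f
    using that
  proof (induction k arbitrary: f)
    case 0
    then have "f = 0" by (simp only: funpow_0)
    then show ?case using cfun.subspace_0[OF subspace_G] L_zero by metis
  next
    case (Suc k)
    have "(shift \<mu> ^^ k) (shift \<mu> f) = 0"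
      using Suc.prems(2) by (simp only: funpow_Suc_right o_apply)
    from Suc.IH[OF shift_in_B[OF Suc.prems(1)] this]
    obtain q where q: "q \<in> G \<mu>" "L q = shift \<mu> f" by blast
    have fG: "f \<in> G \<mu>" using Suc.prems GI by blast
    define u where "u = f - q"
    have u: "u \<in> G \<mu>" unfolding u_def by (rule cfun.subspace_diff[OF subspace_G fG q(1)])
    have "q \<in> B" using q(1) G_subset by blast
    have "L u = L f - shift \<mu> f"
      unfolding u_def L_diff[OF Suc.prems(1) \<open>q \<in> B\<close>] q(2) ..
    then have "L (\<lambda>z. (1 / \<mu>) * u z) = f"
      unfolding L_scale using assms(1) by (simp add: fun_eq_iff)
    moreover have "(\<lambda>z. (1 / \<mu>) * u z) \<in> G \<mu>"
      by (rule cfun.subspace_scale[OF subspace_G u])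
    ultimately show ?case by blast
  qed
  then show ?thesis using assms(2) by (blast elim: GE)
qed

lemma L_power_surj_G:
  assumes "\<mu> \<noteq> 0" "f \<in> G \<mu>"
  shows "\<exists>p\<in>G \<mu>. (L ^^ n) p = f"
proof (induction n)
  case (Suc n)
  then obtain p where p: "p \<in> G \<mu>" "(L ^^ n) p = f" by blast
  obtain p' where "p' \<in> G \<mu>" "L p' = p" using L_surj_G[OF assms(1) p(1)] by blast
  then show ?case using p by (auto simp: funpow_swap1)
qed (use assms in auto)

end

text \<open>\<open>\<phi>\<close> is additive and homogeneous on \<open>G\<close> alone, whereas
  linear maps are total; it is replaced by \<open>\<psi>\<close>, the linear extension of its values
  on a basis of \<open>G\<close>.\<close>

lemma iso_dim:
  fixes \<phi> :: "('a \<Rightarrow> complex) \<Rightarrow> 'b \<Rightarrow> complex"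
  assumes G: "cfun.subspace G"
    and add: "\<And>f g. f \<in> G \<Longrightarrow> g \<in> G \<Longrightarrow> \<phi> (f + g) = \<phi> f + \<phi> g"
    and scale: "\<And>c f. f \<in> G \<Longrightarrow> \<phi> (\<lambda>z. c * f z) = (\<lambda>z. c * \<phi> f z)"
    and inj: "inj_on \<phi> G"
  shows "cfun.dim (\<phi> ` G) = cfun.dim G"
    and "finite F \<Longrightarrow> G \<subseteq> cfun.span F \<Longrightarrow> \<exists>F'. finite F' \<and> \<phi> ` G \<subseteq> cfun.span F'"
proof -
  interpret cpair: vector_space_pair "\<lambda>(c::complex) (f::'a \<Rightarrow> complex) z. c * f z"
    "\<lambda>(c::complex) (f::'b \<Rightarrow> complex) z. c * f z" ..
  obtain b where b: "b \<subseteq> G" "cfun.independent b" "G \<subseteq> cfun.span b" "card b = cfun.dim G"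
    using cfun.basis_exists[of G] by blast
  have span_b: "cfun.span b = G"
    using b cfun.span_minimal[OF b(1) G] by blast
  define \<psi> where "\<psi> = cpair.construct b \<phi>"
  have lin: "Vector_Spaces.linear (\<lambda>(c::complex) (f::'a \<Rightarrow> complex) z. c * f z)
      (\<lambda>(c::complex) (f::'b \<Rightarrow> complex) z. c * f z) \<psi>"
    unfolding \<psi>_def using b(2) by (rule cpair.linear_construct)
  have eq: "\<psi> f = \<phi> f" if "f \<in> G" for f
  proof -
    have "f \<in> cfun.span b" using that span_b by simp
    then have "f \<in> G \<and> \<psi> f = \<phi> f"
    proof (induction rule: cfun.span_induct_alt)
      case base
      have "0 \<in> G" by (rule cfun.subspace_0[OF G])
      then have "\<phi> 0 = 0" using scale[of 0 0] by (simp add: fun_eq_iff zero_fun_def)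
      then show ?case using \<open>0 \<in> G\<close> cpair.linear_0[OF lin] by metis
    next
      case (step c x y)
      have x: "x \<in> G" using step b(1) by blast
      have \<psi>x: "\<psi> x = \<phi> x" unfolding \<psi>_def using b(2) step(1) by (rule cpair.construct_basis)
      have cx: "(\<lambda>z. c * x z) \<in> G" by (rule cfun.subspace_scale[OF G x])
      have "\<psi> ((\<lambda>z. c * x z) + y) = (\<lambda>z. c * \<psi> x z) + \<psi> y"
        by (simp only: cpair.linear_add[OF lin] cpair.linear_scale[OF lin])
      also have "\<dots> = \<phi> ((\<lambda>z. c * x z) + y)"
        using step add[OF cx] scale[OF x] \<psi>x by metis
      finally show ?case using step cfun.subspace_add[OF G cx] by blast
    qed
    then show ?thesis by simp
  qed
  have im: "\<phi> ` G = cfun.span (\<psi> ` b)"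
    using cpair.linear_span_image[OF lin, of b] eq span_b by (metis image_cong)
  have inj': "inj_on \<psi> (cfun.span b)"
    using inj eq by (simp add: span_b inj_on_def)
  have indep: "cfun.independent (\<psi> ` b)"
    using cpair.linear_independent_injective_image[OF lin b(2) inj'] .
  have card: "card (\<psi> ` b) = card b"
    using inj' cfun.span_superset by (metis card_image inj_on_subset)
  show "cfun.dim (\<phi> ` G) = cfun.dim G"
    unfolding im cfun.dim_span using cfun.dim_eq_card_independent[OF indep] card b(4) by simp
  show "\<exists>F'. finite F' \<and> \<phi> ` G \<subseteq> cfun.span F'" if "finite F" "G \<subseteq> cfun.span F"
    using cfun.independent_span_bound[OF that(1) b(2)] b(1) that(2) im by blast
qed

section \<open>Comparison of two admissible domains\<close>

lemma agree_near_commute: "agree_near X f g \<longleftrightarrow> agree_near X g f"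
  unfolding agree_near_def by metis

locale transfer_space_pair =
  a: transfer_space X D I T w S B + b: transfer_space X D' I T' w' S' B'
  for X D D' :: "(complex ^ 'd) set" and I :: "'i set"
    and T T' :: "'i \<Rightarrow> complex ^ 'd \<Rightarrow> complex ^ 'd" and w w' :: "'i \<Rightarrow> complex ^ 'd \<Rightarrow> complex"
    and S S' :: "(complex ^ 'd) set" and B B' :: "(complex ^ 'd \<Rightarrow> complex) set" +
  assumes agree: "\<And>i. i \<in> I \<Longrightarrow> agree_near X (T i) (T' i)" "\<And>i. i \<in> I \<Longrightarrow> agree_near X (w i) (w' i)"
begin

text \<open>Equality of germs along \<open>X\<close>, with a uniform radius so that it combines with
  the equicontinuity of the maps \<open>T i\<close>.\<close>

definition near :: "(complex ^ 'd \<Rightarrow> complex) \<Rightarrow> (complex ^ 'd \<Rightarrow> complex) \<Rightarrow> bool" where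
  "near f g \<longleftrightarrow> (\<exists>\<rho>>0. \<forall>x\<in>X. \<forall>z\<in>ball x \<rho>. f z = g z)"

lemma near_common:
  assumes "near f g" "near f' g'"
  obtains \<rho> where "\<rho> > 0" "\<And>x z. x \<in> X \<Longrightarrow> z \<in> ball x \<rho> \<Longrightarrow> f z = g z \<and> f' z = g' z"
proof -
  obtain \<rho> \<rho>' where "\<rho> > 0" "\<forall>x\<in>X. \<forall>z\<in>ball x \<rho>. f z = g z" "\<rho>' > 0" "\<forall>x\<in>X. \<forall>z\<in>ball x \<rho>'. f' z = g' z"
    using assms unfolding near_def by blast
  then show ?thesis by (intro that[of "min \<rho> \<rho>'"]) auto
qed

lemma near_add: assumes "near f g" "near f' g'" shows "near (f + f') (g + g')"
  using near_common[OF assms] unfolding near_def by (metis plus_fun_apply)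

lemma near_diff: assumes "near f g" "near f' g'" shows "near (f - f') (g - g')"
  using near_common[OF assms] unfolding near_def by (metis fun_diff_def)

lemma near_scale: "near f g \<Longrightarrow> near (\<lambda>z. c * f z) (\<lambda>z. c * g z)"
  unfolding near_def by metis

text \<open>Pulling neighbourhoods back letter by letter gives one that may shrink with the word;
  \<open>words_agree\<close> removes this dependence.\<close>

lemma words_agree_eventually:
  assumes "set is \<subseteq> I" "x \<in> X"
  shows "\<forall>\<^sub>F z in nhds x. fold T is z = fold T' is z \<and> word_weight T w is z = word_weight T' w' is z"
  using assms
proof (induction "is" arbitrary: x)
  case (Cons i "is")
  then have i: "i \<in> I" and x: "x \<in> D" "T i x \<in> X" using a.X a.T_X by auto
  have ag: "\<forall>\<^sub>F z in nhds x. T i z = T' i z \<and> w i z = w' i z"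
    using agree[OF i] Cons.prems(2) unfolding agree_near_def
    by (intro eventually_conj) (meson eventually_nhds subsetD)+
  have "continuous_on D (T i)"
    using a.T_in_U[OF i] closure_subset continuous_on_subset unfolding in_U_def by blast
  then have "isCont (T i) x" using a.domain(1) x(1) continuous_on_eq_continuous_at by blast
  then have "filterlim (T i) (nhds (T i x)) (nhds x)"
    by (simp add: continuous_at tendsto_nhds_iff flip: tendsto_at_iff_tendsto_nhds)
  moreover have "\<forall>\<^sub>F z in nhds (T i x). fold T is z = fold T' is z \<and> word_weight T w is z = word_weight T' w' is z"
    using Cons.IH[OF _ x(2)] Cons.prems(1) by simp
  ultimately have "\<forall>\<^sub>F z in nhds x. fold T is (T i z) = fold T' is (T i z)
      \<and> word_weight T w is (T i z) = word_weight T' w' is (T i z)"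
    by (rule eventually_compose_filterlim[rotated])
  with ag show ?case by eventually_elim auto
qed simp

text \<open>On a ball inside both domains both sides are holomorphic, so agreement near the centre
  spreads over the whole ball by the identity theorem. The radius is dictated by \<open>X\<close>,
  \<open>D\<close> and \<open>D'\<close> and thus serves words of every length.\<close>

lemma words_agree:
  obtains r where "r > 0" "\<And>x. x \<in> X \<Longrightarrow> ball x r \<subseteq> D \<inter> D'"
    "\<And>is x z. set is \<subseteq> I \<Longrightarrow> x \<in> X \<Longrightarrow> z \<in> ball x r \<Longrightarrow>
      fold T is z = fold T' is z \<and> word_weight T w is z = word_weight T' w' is z"
proof -
  obtain r where r: "r > 0" "(\<Union>x\<in>X. ball x r) \<subseteq> D \<inter> D'"
    using compact_subset_open_imp_ball_epsilon_subset[OF a.X(1), of "D \<inter> D'"] a.X(3) b.X(3)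
      a.domain(1) b.domain(1) by (metis le_inf_iff open_Int)
  show ?thesis
  proof (rule that[OF r(1)])
    show sub: "ball x r \<subseteq> D \<inter> D'" if "x \<in> X" for x using r that by blast
    fix "is" x z assume "is": "set is \<subseteq> I" and x: "x \<in> X" and z: "z \<in> ball x r"
    obtain V where V: "open V" "x \<in> V"
      "\<And>z. z \<in> V \<Longrightarrow> fold T is z = fold T' is z \<and> word_weight T w is z = word_weight T' w' is z"
      using words_agree_eventually[OF "is" x] by (auto simp: eventually_nhds)
    have ident: "f z = g z" if "holomorphic_map (*) f (ball x r)" "holomorphic_map (*) g (ball x r)"
      "\<And>z. z \<in> V \<Longrightarrow> f z = g z" for f g :: "complex ^ 'd \<Rightarrow> complex"
    proof -
      have "f z - g z = 0"
        by (rule holomorphic_map_identity[OF holomorphic_map_diff[OF that(1,2)] open_ball connected_ball,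
              of "V \<inter> ball x r"]) (use V r z that(3) in auto)
      then show ?thesis by simp
    qed
    have hol: "holomorphic_map (*s) (fold T is) (ball x r)" "holomorphic_map (*s) (fold T' is) (ball x r)"
      "holomorphic_map (*) (word_weight T w is) (ball x r)" "holomorphic_map (*) (word_weight T' w' is) (ball x r)"
      using a.words_in_U(1,2)[OF "is"] b.words_in_U(1,2)[OF "is"] sub[OF x]
      by (auto simp: in_U_def intro: holomorphic_map_subset)
    have "fold T is z $ k = fold T' is z $ k" for k
      using ident[OF holomorphic_map_component[OF hol(1)] holomorphic_map_component[OF hol(2)]] V(3) by simp
    moreover have "word_weight T w is z = word_weight T' w' is z"
      using ident[OF hol(3,4)] V(3) by blast
    ultimately show "fold T is z = fold T' is z \<and> word_weight T w is z = word_weight T' w' is z"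
      by (simp add: vec_eq_iff)
  qed
qed

text \<open>Points close to \<open>X\<close> are moved to points close to \<open>X\<close> at a rate
  uniform in \<open>i\<close>, so agreement of \<open>f\<close> and \<open>g\<close> on one
  neighbourhood settles all summands at once.\<close>

lemma near_L:
  assumes "near f g" shows "near (a.L f) (b.L g)"
proof -
  obtain \<rho> where \<rho>: "\<rho> > 0" "\<And>x z. x \<in> X \<Longrightarrow> z \<in> ball x \<rho> \<Longrightarrow> f z = g z"
    using assms unfolding near_def by blast
  obtain r where r: "r > 0" "\<And>x. x \<in> X \<Longrightarrow> ball x r \<subseteq> D \<inter> D'"
    "\<And>is x z. set is \<subseteq> I \<Longrightarrow> x \<in> X \<Longrightarrow> z \<in> ball x r \<Longrightarrow>
      fold T is z = fold T' is z \<and> word_weight T w is z = word_weight T' w' is z"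
    using words_agree by blast
  obtain e where e: "e > 0" "\<And>i x z. i \<in> I \<Longrightarrow> x \<in> X \<Longrightarrow> dist x z < e \<Longrightarrow> dist (T i x) (T i z) < \<rho>"
    using a.T_equicontinuous_at_X[OF \<rho>(1)] by blast
  have "a.L f z = b.L g z" if x: "x \<in> X" and z: "z \<in> ball x (min r e)" for x z
  proof -
    have "w i z * f (T i z) = w' i z * g (T' i z)" if i: "i \<in> I" for i
    proof -
      have "T i z = T' i z" "w i z = w' i z" using r(3)[of "[i]" x z] i x z by auto
      moreover have "f (T i z) = g (T i z)"
        using \<rho>(2)[of "T i x" "T i z"] a.T_X[OF i x] e(2)[OF i x, of z] z by simp
      ultimately show ?thesis by simp
    qed
    moreover have "z \<in> S" "z \<in> S'" using r(2)[OF x] z a.S b.S by auto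
    ultimately show ?thesis
      by (simp add: transfer_operator_def restrict_zero_def cong: infsum_cong)
  qed
  then show ?thesis unfolding near_def using r(1) e(1) by (intro exI[of _ "min r e"]) auto
qed

lemma near_shift_power: "near f g \<Longrightarrow> near ((a.shift \<mu> ^^ k) f) ((b.shift \<mu> ^^ k) g)"
  by (induction k) (auto intro: near_diff near_L near_scale)

text \<open>\<open>D'\<close> is connected and contains the nonempty \<open>X\<close>, so a
  vanishing germ forces the function to vanish.\<close>

lemma near_zero_right:
  assumes "g \<in> B'" "near 0 g" shows "g = 0"
proof (rule b.B_zero[OF assms(1)])
  obtain \<rho> where \<rho>: "\<rho> > 0" "\<And>x z. x \<in> X \<Longrightarrow> z \<in> ball x \<rho> \<Longrightarrow> 0 = g z"
    using assms(2) unfolding near_def by auto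
  obtain x where x: "x \<in> X" using a.X by blast
  show "g z = 0" if "z \<in> D'" for z
    by (rule holomorphic_map_identity[OF b.B_hol[OF assms(1)] b.domain(1,2),
          of "D' \<inter> ball x \<rho>"]) (use b.X x \<rho> b.domain that in \<open>auto 0 3 intro: exI[of _ x]\<close>)
qed

lemma near_unique_right:
  assumes "g \<in> B'" "g' \<in> B'" "near f g" "near f g'" shows "g = g'"
  using near_zero_right[OF b.B_diff[OF assms(1,2)]] near_diff[OF assms(3,4)] by simp

text \<open>The wanted \<open>g\<close> is formally the \<open>m\<close>-th iterate, on
  \<open>D'\<close>, of a function \<open>p\<close> that lives on \<open>D\<close>. This makes sense
  because words of length \<open>m\<close> carry all of \<open>D'\<close> into a small neighbourhood
  \<open>Q\<close> of \<open>X\<close>, where \<open>p\<close> is available.\<close>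

lemma ex_near:
  assumes \<mu>: "\<mu> \<noteq> 0" and f: "f \<in> a.G \<mu>"
  shows "\<exists>g\<in>b.G \<mu>. near f g"
proof -
  obtain r where r: "r > 0" "\<And>x. x \<in> X \<Longrightarrow> ball x r \<subseteq> D \<inter> D'"
    "\<And>is x z. set is \<subseteq> I \<Longrightarrow> x \<in> X \<Longrightarrow> z \<in> ball x r \<Longrightarrow>
      fold T is z = fold T' is z \<and> word_weight T w is z = word_weight T' w' is z"
    using words_agree by blast
  \<comment> \<open>The closed \<open>r / 2\<close>-neighbourhood of \<open>X\<close>: compact, and
    inside the balls of radius \<open>r\<close>, hence inside \<open>D\<close>.\<close>
  define Q where "Q = {x + y |x y. x \<in> X \<and> y \<in> cball 0 (r / 2)}"
  have "compact Q" unfolding Q_def using a.X(1) by (intro compact_sums) auto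
  have "Q \<subseteq> D"
  proof
    fix z assume "z \<in> Q"
    then obtain x y where "x \<in> X" "z = x + y" "norm y \<le> r / 2" by (auto simp: Q_def)
    then have "x \<in> X" "z \<in> ball x r" using r(1) by (auto simp: dist_norm)
    then show "z \<in> D" using r(2) by blast
  qed
  obtain m where m: "\<And>is z. set is \<subseteq> I \<Longrightarrow> m \<le> length is \<Longrightarrow> z \<in> closure D' \<Longrightarrow> \<exists>x\<in>X. dist x (fold T' is z) < r / 2"
    using b.words_approach_X[of "r / 2"] r(1) by auto
  have in_Q: "fold T' is ` closure D' \<subseteq> Q" if "is": "is \<in> words I m" for "is"
  proof
    fix y assume "y \<in> fold T' is ` closure D'"
    then obtain z where "z \<in> closure D'" "y = fold T' is z" by blast
    then obtain x where "x \<in> X" "dist x y < r / 2" using m[of "is" z] "is" by (auto simp: words_def)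
    then have "y = x + (y - x)" "y - x \<in> cball 0 (r / 2)" by (auto simp: dist_norm norm_minus_commute)
    with \<open>x \<in> X\<close> show "y \<in> Q" unfolding Q_def by blast
  qed
  obtain p where p: "p \<in> a.G \<mu>" "(a.L ^^ m) p = f" using a.L_power_surj_G[OF assms] by blast
  have p_hol: "holomorphic_map (*) p D" using p(1) a.G_subset a.B_hol by blast
  define h where "h z = (\<Sum>\<^sub>\<infinity>is\<in>words I m. word_weight T' w' is z * p (fold T' is z))" for z
  define g where "g = restrict_zero S' h"
  have "in_U (*) D' h"
    unfolding h_def
  proof (rule weighted_composition_in_U[OF b.domain(1) _ in_Q _ _ b.summable_word_norms p_hol \<open>compact Q\<close> \<open>Q \<subseteq> D\<close>])
    fix "is" assume "is \<in> words I m"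
    then have *: "set is \<subseteq> I" by (simp add: words_def)
    show "in_U (*s) D' (fold T' is)" "in_U (*) D' (word_weight T' w' is)"
      using b.words_in_U(1,2)[OF *] .
    show "cmod (word_weight T' w' is z) \<le> (\<Prod>i\<leftarrow>is. U_norm D' (w' i))" if "z \<in> closure D'" for z
      using b.words_in_U(3)[OF * that] .
  qed
  then have g: "g \<in> B'" unfolding g_def by (rule b.B_contains)
  have "near f g"
    unfolding near_def
  proof (intro exI[of _ r] conjI ballI)
    fix x z assume x: "x \<in> X" and z: "z \<in> ball x r"
    then have "z \<in> D" "z \<in> S" "z \<in> S'" using r(2) a.S b.S by blast+
    have "f z = (\<Sum>\<^sub>\<infinity>is\<in>words I m. word_weight T w is z * p (fold T is z))"
      unfolding p(2)[symmetric]
      by (rule a.transfer_operator_iterate[OF a.S holomorphic_map_continuous_on[OF p_hol] \<open>z \<in> S\<close>])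
    also have "\<dots> = g z"
      using \<open>z \<in> S'\<close> r(3)[OF _ x z] unfolding g_def restrict_zero_def h_def
      by (auto intro!: infsum_cong simp: words_def)
    finally show "f z = g z" .
  qed (rule r(1))
  moreover obtain k where k: "(a.shift \<mu> ^^ k) f = 0" using f by (rule a.GE)
  \<comment> \<open>The powers applied to \<open>f\<close> and \<open>g\<close> have the same germ,
    and the one for \<open>f\<close> is 0; the identity theorem then kills the one for
    \<open>g\<close>.\<close>
  have "(b.shift \<mu> ^^ k) g = 0"
    using near_shift_power[OF \<open>near f g\<close>, of k \<mu>] b.shift_power_in_B[OF g] near_zero_right
    unfolding k by blast
  then have "g \<in> b.G \<mu>" using g b.GI by blast
  ultimately show ?thesis by blast
qed

lemma swapped: "transfer_space_pair X D' D I T' T w' w S' S B' B"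
  by unfold_locales (simp_all only: agree agree_near_commute[of X "T' _"] agree_near_commute[of X "w' _"])

interpretation swap: transfer_space_pair X D' D I T' T w' w S' S B' B
  by (rule swapped)

lemma near_commute: "near f g \<Longrightarrow> near g f"
  unfolding near_def by metis

text \<open>Partners with the same germ are chosen arbitrarily. Linearity follows from their
  uniqueness, injectivity and surjectivity from uniqueness and existence with the two domains
  exchanged.\<close>

lemma iso_generalized_eigenspaces:
  assumes \<mu>: "\<mu> \<noteq> 0"
  shows "cfun.dim (b.G \<mu>) = cfun.dim (a.G \<mu>)"
    and "finite F \<Longrightarrow> a.G \<mu> \<subseteq> cfun.span F \<Longrightarrow> \<exists>F'. finite F' \<and> b.G \<mu> \<subseteq> cfun.span F'"
proof -
  have "\<forall>f\<in>a.G \<mu>. \<exists>g. g \<in> b.G \<mu> \<and> near f g" using ex_near[OF \<mu>] by blast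
  then obtain \<phi> where \<phi>: "\<And>f. f \<in> a.G \<mu> \<Longrightarrow> \<phi> f \<in> b.G \<mu>" "\<And>f. f \<in> a.G \<mu> \<Longrightarrow> near f (\<phi> f)"
    by metis
  have \<phi>_eq: "\<phi> f = g" if "f \<in> a.G \<mu>" "g \<in> b.G \<mu>" "near f g" for f g
    using near_unique_right[OF _ _ \<phi>(2) that(3)] \<phi>(1) that b.G_subset by blast
  have add: "\<phi> (f + g) = \<phi> f + \<phi> g" if "f \<in> a.G \<mu>" "g \<in> a.G \<mu>" for f g
    using that \<phi> by (intro \<phi>_eq near_add cfun.subspace_add[OF a.subspace_G] cfun.subspace_add[OF b.subspace_G])
  have scale: "\<phi> (\<lambda>z. c * f z) = (\<lambda>z. c * \<phi> f z)" if "f \<in> a.G \<mu>" for c f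
    using that \<phi> by (intro \<phi>_eq near_scale cfun.subspace_scale[OF a.subspace_G] cfun.subspace_scale[OF b.subspace_G])
  have inj: "inj_on \<phi> (a.G \<mu>)"
  proof (rule inj_onI)
    fix f g assume *: "f \<in> a.G \<mu>" "g \<in> a.G \<mu>" "\<phi> f = \<phi> g"
    have "f \<in> B" "g \<in> B" using *(1,2) a.G_subset by blast+
    moreover have "near (\<phi> f) f" "near (\<phi> f) g"
      using near_commute[OF \<phi>(2)[OF *(1)]] near_commute[OF \<phi>(2)[OF *(2)]] *(3) by simp_all
    ultimately show "f = g" by (rule swap.near_unique_right)
  qed
  have im: "\<phi> ` a.G \<mu> = b.G \<mu>"
  proof
    show "b.G \<mu> \<subseteq> \<phi> ` a.G \<mu>"
    proof
      fix g assume g: "g \<in> b.G \<mu>"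
      from swap.ex_near[OF \<mu> g] obtain f where f: "f \<in> a.G \<mu>" "near f g"
        using near_commute by blast
      from \<phi>_eq[OF f(1) g f(2)] f(1) show "g \<in> \<phi> ` a.G \<mu>" by blast
    qed
  qed (use \<phi> in auto)
  show "cfun.dim (b.G \<mu>) = cfun.dim (a.G \<mu>)"
    using iso_dim(1)[OF a.subspace_G add scale inj] unfolding im by simp
  show "finite F \<Longrightarrow> a.G \<mu> \<subseteq> cfun.span F \<Longrightarrow> \<exists>F'. finite F' \<and> b.G \<mu> \<subseteq> cfun.span F'"
    using iso_dim(2)[OF a.subspace_G add scale inj] unfolding im by simp
qed

end

context transfer_space_pair
begin

interpretation swap: transfer_space_pair X D' D I T' T w' w S' S B' B
  by (rule swapped)

lemma algebraic_multiplicity_eq: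
  assumes "\<mu> \<noteq> 0"
  shows "algebraic_multiplicity B a.L \<mu> = algebraic_multiplicity B' b.L \<mu>"
  unfolding algebraic_multiplicity_def
  using iso_generalized_eigenspaces[OF assms] swap.iso_generalized_eigenspaces(2)[OF assms] by metis

lemma eigenvalue_sequences_eq: "eigenvalue_sequences B a.L = eigenvalue_sequences B' b.L"
  unfolding eigenvalue_sequences_def by (simp add: algebraic_multiplicity_eq)

end

section \<open>Riesz theory\<close>

text \<open>Finite-dimensional subspaces are closed; shown for an explicit norm \<open>N\<close> by
  adding one spanning vector at a time.\<close>

lemma finite_span_distance:
  fixes N :: "('a \<Rightarrow> complex) \<Rightarrow> real"
  assumes A: "cfun.subspace A"
    and tri: "\<And>f g. f \<in> A \<Longrightarrow> g \<in> A \<Longrightarrow> N (f + g) \<le> N f + N g"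
    and scale: "\<And>c f. f \<in> A \<Longrightarrow> N (\<lambda>z. c * f z) = cmod c * N f"
    and pos: "\<And>f. f \<in> A \<Longrightarrow> f \<noteq> 0 \<Longrightarrow> 0 < N f"
    and F: "finite F" "F \<subseteq> A" and h: "h \<in> A" "h \<notin> cfun.span F"
  shows "\<exists>\<delta>>0. \<forall>v\<in>cfun.span F. \<delta> \<le> N (h - v)"
  using F h
proof (induction F arbitrary: h)
  case empty
  then show ?case using pos[of h] by (intro exI[of _ "N h"]) auto
next
  case (insert b F)
  have sub: "cfun.span F \<subseteq> A" using cfun.span_minimal[OF _ A] insert.prems(1) by blast
  show ?case
  proof (cases "b \<in> cfun.span F")
    case True
    then show ?thesis using insert by (simp add: cfun.span_redundant)
  next
    case False
    have b: "b \<in> A" using insert.prems by blast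
    obtain \<delta> where \<delta>: "\<delta> > 0" "\<And>v. v \<in> cfun.span F \<Longrightarrow> \<delta> \<le> N (b - v)"
      using insert.IH[OF _ b False] insert.prems(1) by blast
    have minus: "f - g \<in> A" if "f \<in> A" "g \<in> A" for f g
      using cfun.subspace_diff[OF A that] .
    have smult: "(\<lambda>z. c * f z) \<in> A" if "f \<in> A" for c f
      using cfun.subspace_scale[OF A that] .
    have tri_diff: "N (f - g) \<le> N f + N g" if "f \<in> A" "g \<in> A" for f g
    proof -
      have "f - g = f + (\<lambda>z. -1 * g z)" by (simp add: fun_eq_iff)
      then have "N (f - g) \<le> N f + cmod (-1) * N g"
        using tri[OF that(1) smult[OF that(2), of "-1"]] scale[OF that(2), of "-1"] by metis
      then show ?thesis by simp
    qed
    have nonneg: "0 \<le> N f" if "f \<in> A" for f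
    proof (cases "f = 0")
      case True
      then show ?thesis using scale[OF that, of 0] by (simp add: zero_fun_def)
    qed (use pos[OF that] in simp)
    \<comment> \<open>The coefficient of \<open>b\<close> is controlled by the norm, since
      \<open>b\<close> has distance at least \<open>\<delta>\<close> from the old span.\<close>
    have b_lower: "cmod c * \<delta> \<le> N ((\<lambda>z. c * b z) - v)" if v: "v \<in> cfun.span F" for c v
    proof (cases "c = 0")
      case True
      have "(\<lambda>z. c * b z) - v \<in> A" using v sub smult[OF b] minus by blast
      then show ?thesis using nonneg True by fastforce
    next
      case False
      define v' where "v' = (\<lambda>z. (1 / c) * v z)"
      have v': "v' \<in> cfun.span F" unfolding v'_def by (rule cfun.span_scale[OF v])
      have "b - v' \<in> A" using v' sub b minus by blast
      from scale[OF this, of c] \<delta>(2)[OF v'] have "cmod c * \<delta> \<le> N (\<lambda>z. c * (b - v') z)"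
        by (simp add: mult_left_mono)
      also have "(\<lambda>z. c * (b - v') z) = (\<lambda>z. c * b z) - v"
        using False by (simp add: v'_def fun_eq_iff algebra_simps)
      finally show ?thesis .
    qed
    show ?thesis
    proof (rule ccontr)
      \<comment> \<open>Approximants of \<open>h\<close> in the larger span have Cauchy coefficients
        \<open>c n\<close> at \<open>b\<close>. With their limit \<open>l\<close>, the difference of
        \<open>h\<close> and \<open>l\<close> times \<open>b\<close> is approximated arbitrarily
        well from the old span, against the induction hypothesis.\<close>
      assume neg: "\<not> ?thesis"
      have "\<exists>c. \<exists>u\<in>cfun.span F. N (h - (\<lambda>z. c * b z) - u) < 1 / Suc n" for n
      proof -
        obtain v where v: "v \<in> cfun.span (insert b F)" "N (h - v) < 1 / Suc n"
          using neg by (metis linorder_not_le of_nat_0_less_iff zero_less_Suc zero_less_divide_1_iff)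
        then obtain c where c: "v - (\<lambda>z. c * b z) \<in> cfun.span F"
          by (auto simp: cfun.span_breakdown_eq)
        have "h - (\<lambda>z. c * b z) - (v - (\<lambda>z. c * b z)) = h - v" by (simp add: fun_eq_iff)
        then show ?thesis using c v(2) by metis
      qed
      then obtain c u where cu: "\<And>n. u n \<in> cfun.span F" "\<And>n. N (h - (\<lambda>z. c n * b z) - u n) < 1 / Suc n"
        by metis
      define d where "d n = h - (\<lambda>z. c n * b z) - u n" for n
      have dA: "d n \<in> A" for n
        unfolding d_def using cu(1) sub smult[OF b] minus insert.prems(2) by blast
      have d_small: "N (d n) \<le> 1 / Suc M" if "M \<le> n" for n M
      proof -
        have "1 / real (Suc n) \<le> 1 / real (Suc M)" using that by (intro divide_left_mono) auto
        then show ?thesis using cu(2)[of n] by (simp add: d_def)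
      qed
      have "Cauchy c"
      proof (rule CauchyI)
        fix e :: real assume e: "e > 0"
        obtain M where M: "2 / (e * \<delta>) < real (Suc M)"
          using reals_Archimedean2 by (meson less_SucI of_nat_less_iff order_less_trans lessI)
        have "cmod (c m - c n) < e" if mn: "M \<le> m" "M \<le> n" for m n
        proof -
          have "(\<lambda>z. (c m - c n) * b z) - (u n - u m) = d n - d m"
            by (simp add: d_def fun_eq_iff algebra_simps)
          then have "cmod (c m - c n) * \<delta> \<le> N (d n - d m)"
            using b_lower[OF cfun.span_diff[OF cu(1)[of n] cu(1)[of m]], of "c m - c n"] by simp
          also have "\<dots> \<le> N (d n) + N (d m)" by (rule tri_diff[OF dA dA])
          also have "\<dots> \<le> 2 / Suc M" using add_mono[OF d_small[OF mn(2)] d_small[OF mn(1)]] by (simp flip: add_divide_distrib)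
          also have "\<dots> < e * \<delta>" using M e \<delta>(1) by (simp add: field_simps)
          finally show ?thesis using \<delta>(1) by simp
        qed
        then show "\<exists>M. \<forall>m\<ge>M. \<forall>n\<ge>M. cmod (c m - c n) < e" by blast
      qed
      then obtain l where l: "c \<longlonglongrightarrow> l" using Cauchy_convergent convergent_def by blast
      define h' where "h' = h - (\<lambda>z. l * b z)"
      have h'A: "h' \<in> A" unfolding h'_def using smult[OF b] minus insert.prems(2) by blast
      have "h' \<notin> cfun.span F" using insert.prems(3) unfolding h'_def cfun.span_breakdown_eq by blast
      then obtain \<delta>' where \<delta>': "\<delta>' > 0" "\<And>v. v \<in> cfun.span F \<Longrightarrow> \<delta>' \<le> N (h' - v)"
        using insert.IH[OF _ h'A] insert.prems(1) by blast
      have le: "\<delta>' \<le> 1 / Suc n + cmod (c n - l) * N b" for n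
      proof -
        have "h' - u n = d n + (\<lambda>z. (c n - l) * b z)"
          by (simp add: d_def h'_def fun_eq_iff algebra_simps)
        then have "N (h' - u n) \<le> N (d n) + cmod (c n - l) * N b"
          using tri[OF dA[of n] smult[OF b, of "c n - l"]] scale[OF b] by simp
        then show ?thesis using \<delta>'(2)[OF cu(1)[of n]] d_small[of n n] by simp
      qed
      have "(\<lambda>n. 1 / Suc n + cmod (c n - l) * N b) \<longlonglongrightarrow> 0 + 0 * N b"
        using l by (intro tendsto_add tendsto_mult tendsto_const LIMSEQ_Suc[OF lim_1_over_n]
            tendsto_norm_zero LIM_zero)
      then have "\<delta>' \<le> 0 + 0 * N b"
        by (rule LIMSEQ_le_const) (use le in auto)
      then show False using \<delta>'(1) by simp
    qed
  qed
qed

text \<open>A vector of the span that comes within twice the distance of \<open>h\<close> is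
  subtracted and the result normalised, hence the constant \<open>1 / 2\<close>. The multiple of
  \<open>h\<close> is recorded because an eigenvalue relation modulo the span has to pass from
  \<open>h\<close> to \<open>y\<close>.\<close>

lemma Riesz_lemma_span:
  fixes N :: "('a \<Rightarrow> complex) \<Rightarrow> real"
  assumes A: "cfun.subspace A"
    and tri: "\<And>f g. f \<in> A \<Longrightarrow> g \<in> A \<Longrightarrow> N (f + g) \<le> N f + N g"
    and scale: "\<And>c f. f \<in> A \<Longrightarrow> N (\<lambda>z. c * f z) = cmod c * N f"
    and pos: "\<And>f. f \<in> A \<Longrightarrow> f \<noteq> 0 \<Longrightarrow> 0 < N f"
    and F: "finite F" "F \<subseteq> A" and h: "h \<in> A" "h \<notin> cfun.span F"
  obtains y c where "y \<in> A" "N y = 1" "y - (\<lambda>z. c * h z) \<in> cfun.span F"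
    "\<And>u. u \<in> cfun.span F \<Longrightarrow> 1 / 2 \<le> N (y - u)"
proof -
  have sub: "cfun.span F \<subseteq> A" using cfun.span_minimal[OF F(2) A] .
  obtain \<delta> where \<delta>: "\<delta> > 0" "\<And>v. v \<in> cfun.span F \<Longrightarrow> \<delta> \<le> N (h - v)"
    using finite_span_distance[OF A tri scale pos F h] by blast
  define d where "d = (INF v\<in>cfun.span F. N (h - v))"
  have ne: "cfun.span F \<noteq> {}" using cfun.span_zero by blast
  have bdd: "bdd_below ((\<lambda>v. N (h - v)) ` cfun.span F)" by (rule bdd_belowI2[OF \<delta>(2)])
  have "\<delta> \<le> d" unfolding d_def by (rule cINF_greatest[OF ne \<delta>(2)])
  then have d: "d > 0" using \<delta>(1) by simp
  then obtain v where v: "v \<in> cfun.span F" "N (h - v) < 2 * d"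
    using cINF_less_iff[OF ne bdd, of "2 * d"] by (auto simp: d_def)
  define s where "s = N (h - v)"
  have s: "s > 0" "s < 2 * d" using \<delta> v by (auto simp: s_def intro: less_le_trans)
  have hv: "h - v \<in> A" using cfun.subspace_diff[OF A h(1)] v(1) sub by blast
  define y where "y = (\<lambda>z. of_real (1 / s) * (h - v) z)"
  have N_scaled: "N (\<lambda>z. of_real (1 / s) * f z) = N f / s" if "f \<in> A" for f
    using scale[OF that, of "of_real (1 / s)"] s by (simp add: norm_divide)
  show ?thesis
  proof (rule that)
    show "y \<in> A" unfolding y_def by (rule cfun.subspace_scale[OF A hv])
    show "N y = 1" unfolding y_def N_scaled[OF hv] using s by (simp add: s_def)
    have "y - (\<lambda>z. of_real (1 / s) * h z) = (\<lambda>z. (- of_real (1 / s)) * v z)"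
      by (simp add: y_def fun_eq_iff algebra_simps)
    then show "y - (\<lambda>z. of_real (1 / s) * h z) \<in> cfun.span F"
      using cfun.span_scale[OF v(1), of "- of_real (1 / s)"] by metis
    show "1 / 2 \<le> N (y - u)" if u: "u \<in> cfun.span F" for u
    proof -
      define v' where "v' = v + (\<lambda>z. of_real s * u z)"
      have v': "v' \<in> cfun.span F" unfolding v'_def by (intro cfun.span_add v(1) cfun.span_scale u)
      have hv': "h - v' \<in> A" using cfun.subspace_diff[OF A h(1)] v' sub by blast
      have "y - u = (\<lambda>z. of_real (1 / s) * (h - v') z)"
        using s by (simp add: y_def v'_def fun_eq_iff field_simps)
      then have "N (y - u) = N (h - v') / s" by (simp only: N_scaled[OF hv'])
      moreover have "d \<le> N (h - v')" unfolding d_def by (rule cINF_lower[OF bdd v'])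
      ultimately have "d / s \<le> N (y - u)" using s by (simp add: divide_right_mono)
      moreover have "1 / 2 < d / s" using s d by (simp add: field_simps)
      ultimately show ?thesis by linarith
    qed
  qed
qed

context transfer_space
begin

lemma L_span_invariant:
  assumes F: "F \<subseteq> B" "\<And>f. f \<in> F \<Longrightarrow> L f \<in> cfun.span F" and f: "f \<in> cfun.span F"
  shows "L f \<in> cfun.span F"
proof -
  have "f \<in> B \<and> L f \<in> cfun.span F"
    using f
  proof (induction rule: cfun.span_induct_alt)
    case base
    show ?case using cfun.subspace_0[OF subspace_B] cfun.span_zero[of F] L_zero by metis
  next
    case (step c x y)
    have x: "x \<in> B" using step(1) F(1) by blast
    have "L ((\<lambda>z. c * x z) + y) = (\<lambda>z. c * L x z) + L y"
      using step L_add[OF B_scale[OF x]] L_scale by metis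
    then show ?case
      using step F(2)[OF step(1)] B_add[OF B_scale[OF x]] cfun.span_add[OF cfun.span_scale] by metis
  qed
  then show ?thesis ..
qed

text \<open>The last nonzero iterate of \<open>shift \<mu>\<close> on \<open>f\<close> is an
  eigenvector.\<close>

lemma ex_eigenvector:
  assumes "f \<in> G \<mu>" "f \<noteq> 0"
  obtains e where "e \<in> G \<mu>" "e \<noteq> 0" "L e = (\<lambda>z. \<mu> * e z)"
proof -
  obtain k where k: "f \<in> B" "(shift \<mu> ^^ k) f = 0" using assms(1) by (rule GE)
  define j where "j = (LEAST k. (shift \<mu> ^^ k) f = 0)"
  have j: "(shift \<mu> ^^ j) f = 0" unfolding j_def by (rule LeastI[of _ k]) (rule k(2))
  have "j \<noteq> 0" using j assms(2) by (metis funpow_0)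
  then obtain i where i: "j = Suc i" using not0_implies_Suc by blast
  define e where "e = (shift \<mu> ^^ i) f"
  have e: "e \<noteq> 0"
    unfolding e_def using not_less_Least[of i "\<lambda>k. (shift \<mu> ^^ k) f = 0"] i unfolding j_def by simp
  have se: "shift \<mu> e = 0"
    unfolding e_def using j unfolding i by (simp only: funpow.simps o_apply)
  have "e \<in> B" unfolding e_def by (rule shift_power_in_B[OF k(1)])
  then have "e \<in> G \<mu>" by (rule GI[where k = "Suc 0"]) (use se in \<open>simp only: funpow.simps o_apply id_apply\<close>)
  moreover have "L e = (\<lambda>z. \<mu> * e z)" using se by (metis eq_iff_diff_eq_0)
  ultimately show ?thesis using that e by blast
qed

text \<open>Let \<open>u\<close> be \<open>f\<close> without its component along
  \<open>e \<mu>\<close>. Then \<open>L u\<close> minus \<open>\<mu>\<close> times \<open>u\<close>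
  equals \<open>\<nu> - \<mu>\<close> times \<open>f\<close> and lies in the span of the remaining
  eigenvectors, so \<open>f\<close> lies there too.\<close>

lemma eigenvectors_span:
  assumes "finite M" "\<And>\<mu>. \<mu> \<in> M \<Longrightarrow> e \<mu> \<in> B \<and> L (e \<mu>) = (\<lambda>z. \<mu> * e \<mu> z)"
    and "f \<in> cfun.span (e ` M)" "L f = (\<lambda>z. \<nu> * f z)" "\<nu> \<notin> M"
  shows "f = 0"
  using assms
proof (induction M arbitrary: f)
  case (insert \<mu> M)
  have sub: "e ` M \<subseteq> B" using insert.prems(1) by blast
  have \<mu>: "e \<mu> \<in> B" "L (e \<mu>) = (\<lambda>z. \<mu> * e \<mu> z)" using insert.prems(1) by auto
  obtain c where "f - (\<lambda>z. c * e \<mu> z) \<in> cfun.span (e ` M)"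
    using insert.prems(2) by (auto simp: cfun.span_breakdown_eq)
  then obtain u where u: "u \<in> cfun.span (e ` M)" "u = f - (\<lambda>z. c * e \<mu> z)" by blast
  have "u \<in> B" using cfun.span_minimal[OF sub subspace_B] u(1) by blast
  have f: "f = u + (\<lambda>z. c * e \<mu> z)" unfolding u(2) by (simp add: fun_eq_iff)
  have "L f = L u + (\<lambda>z. c * (\<mu> * e \<mu> z))"
    unfolding f L_add[OF \<open>u \<in> B\<close> B_scale[OF \<mu>(1)]] L_scale \<mu>(2) ..
  then have Lf: "\<nu> * f z = L u z + c * (\<mu> * e \<mu> z)" for z
    unfolding insert.prems(3) by (metis plus_fun_apply)
  have fz: "f z = u z + c * e \<mu> z" for z by (simp add: u(2))
  have "L u - (\<lambda>z. \<mu> * u z) = (\<lambda>z. (\<nu> - \<mu>) * f z)"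
  proof
    fix z show "(L u - (\<lambda>z. \<mu> * u z)) z = (\<nu> - \<mu>) * f z"
      using Lf[of z] by (simp add: fz algebra_simps)
  qed
  moreover have "L u \<in> cfun.span (e ` M)"
  proof (rule L_span_invariant[OF sub _ u(1)])
    fix g assume "g \<in> e ` M"
    then obtain \<kappa> where "\<kappa> \<in> M" "g = e \<kappa>" by blast
    then have "L g = (\<lambda>z. \<kappa> * g z)" using insert.prems(1) by blast
    then show "L g \<in> cfun.span (e ` M)" using cfun.span_scale[OF cfun.span_base[OF \<open>g \<in> e ` M\<close>]] by metis
  qed
  ultimately have "(\<lambda>z. (\<nu> - \<mu>) * f z) \<in> cfun.span (e ` M)"
    using cfun.span_diff[OF _ cfun.span_scale[OF u(1)]] by metis
  from cfun.span_scale[OF this, of "1 / (\<nu> - \<mu>)"] have "f \<in> cfun.span (e ` M)"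
    using insert.prems(4) by simp
  then show ?case using insert.IH insert.prems by blast
qed simp

text \<open>Eigenvectors for distinct eigenvalues are independent and lie in one finite-dimensional
  span, so \<open>card F\<close> bounds their number.\<close>

lemma finite_eigenvalues:
  assumes F: "finite F" "\<And>\<mu>. \<mu> \<in> M \<Longrightarrow> G \<mu> \<subseteq> cfun.span F" "\<And>\<mu>. \<mu> \<in> M \<Longrightarrow> G \<mu> \<noteq> {0}"
  shows "finite M"
proof -
  have "\<exists>e. e \<in> G \<mu> \<and> e \<noteq> 0 \<and> L e = (\<lambda>z. \<mu> * e z)" if \<mu>: "\<mu> \<in> M" for \<mu>
  proof -
    obtain f where "f \<in> G \<mu>" "f \<noteq> 0" using F(3)[OF \<mu>] cfun.subspace_0[OF subspace_G] by blast
    then show ?thesis by (metis ex_eigenvector)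
  qed
  then obtain e where e: "\<And>\<mu>. \<mu> \<in> M \<Longrightarrow> e \<mu> \<in> G \<mu>" "\<And>\<mu>. \<mu> \<in> M \<Longrightarrow> e \<mu> \<noteq> 0"
      "\<And>\<mu>. \<mu> \<in> M \<Longrightarrow> L (e \<mu>) = (\<lambda>z. \<mu> * e \<mu> z)"
    by metis
  have indep: "cfun.independent (e ` M') \<and> card (e ` M') = card M'" if "finite M'" "M' \<subseteq> M" for M'
    using that
  proof (induction M')
    case (insert \<nu> M')
    have "e \<nu> \<notin> cfun.span (e ` M')"
      using eigenvectors_span[OF insert.hyps(1), of e "e \<nu>" \<nu>] e G_subset insert by blast
    then show ?case
      using insert cfun.span_base[of "e \<nu>" "e ` M'"] by (auto simp: cfun.independent_insert)
  qed (simp add: cfun.independent_empty)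
  have "card M' \<le> card F" if M': "M' \<subseteq> M" "finite M'" for M'
  proof -
    have "e ` M' \<subseteq> cfun.span F" using M'(1) e(1) F(2) by blast
    then show ?thesis using cfun.independent_span_bound[OF F(1)] indep[OF M'(2,1)] by metis
  qed
  then show ?thesis by (meson finite_if_finite_subsets_card_bdd)
qed

end

section \<open>The normed space U(D) and compactness of the transfer operator\<close>

lemma U_space_iff: "f \<in> U_space D \<longleftrightarrow> in_U (*) D f \<and> (\<forall>z. z \<notin> closure D \<longrightarrow> f z = 0)"
  by (simp add: U_space_def)

lemma subspace_U_space: "cfun.subspace (U_space D)"
  unfolding cfun.subspace_def
proof (intro conjI ballI allI)
  show "0 \<in> U_space D"
    by (simp add: U_space_iff in_U_def zero_fun_def holomorphic_map_const)
next
  fix f g assume "f \<in> U_space D" "g \<in> U_space D"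
  then show "f + g \<in> U_space D"
    by (auto simp: U_space_iff in_U_def plus_fun_def distrib_left
        intro!: holomorphic_map_add continuous_on_add)
next
  fix c f assume "f \<in> U_space D"
  then show "(\<lambda>z. c * f z) \<in> U_space D"
    by (auto simp: U_space_iff in_U_def
        intro!: holomorphic_map_mult holomorphic_map_const continuous_intros)
qed

lemma restrict_zero_in_U:
  assumes "in_U (*) D f" "open D"
  shows "in_U (*) D (restrict_zero (closure D) f)"
  unfolding in_U_def
proof
  show "continuous_on (closure D) (restrict_zero (closure D) f)"
    using assms by (auto simp: in_U_def restrict_zero_def cong: continuous_on_cong)
  show "holomorphic_map (*) (restrict_zero (closure D) f) D"
    by (rule holomorphic_map_cong[of _ f, OF _ assms(2)])
       (use assms(1) closure_subset in \<open>auto simp: in_U_def restrict_zero_def\<close>)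
qed

context map_weight_system
begin

lemma transfer_space_U: "transfer_space X D I T w (closure D) (U_space D)"
proof unfold_locales
  show "D \<subseteq> closure D" by (rule closure_subset)
  show "cfun.subspace (U_space D)" by (rule subspace_U_space)
  show "holomorphic_map (*) f D" if "f \<in> U_space D" for f
    using that by (simp add: U_space_iff in_U_def)
  show "f = 0" if "f \<in> U_space D" "\<And>z. z \<in> D \<Longrightarrow> f z = 0" for f
  proof
    fix z
    have "f z = 0" if "z \<in> closure D"
      using continuous_constant_on_closure[of D f 0 z] \<open>f \<in> U_space D\<close> \<open>\<And>z. z \<in> D \<Longrightarrow> f z = 0\<close> that
      by (auto simp: U_space_iff in_U_def)
    then show "f z = 0 z" using \<open>f \<in> U_space D\<close> by (auto simp: U_space_iff)
  qed
  show "restrict_zero (closure D) f \<in> U_space D" if "in_U (*) D f" for f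
    using restrict_zero_in_U[OF that domain(1)] by (simp add: U_space_iff restrict_zero_def)
qed simp

interpretation U: transfer_space X D I T w "closure D" "U_space D"
  by (rule transfer_space_U)

lemma U_norm_bound: "f \<in> U_space D \<Longrightarrow> z \<in> closure D \<Longrightarrow> cmod (f z) \<le> U_norm D f"
  using norm_le_U_norm[OF domain(3), of f z] by (simp add: U_space_iff in_U_def)

lemma U_norm_add:
  assumes "f \<in> U_space D" "g \<in> U_space D" shows "U_norm D (f + g) \<le> U_norm D f + U_norm D g"
proof (rule U_norm_least[OF domain(4)])
  fix z assume "z \<in> closure D"
  then show "cmod ((f + g) z) \<le> U_norm D f + U_norm D g"
    unfolding plus_fun_apply
    by (intro norm_triangle_mono U_norm_bound[OF assms(1)] U_norm_bound[OF assms(2)])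
qed

lemma U_norm_scale_le:
  assumes "f \<in> U_space D" shows "U_norm D (\<lambda>z. c * f z) \<le> cmod c * U_norm D f"
  using U_norm_bound[OF assms]
  by (intro U_norm_least[OF domain(4)]) (simp add: norm_mult mult_left_mono)

lemma U_norm_nonneg: "f \<in> U_space D \<Longrightarrow> 0 \<le> U_norm D f"
  using U_norm_bound domain(4) closure_subset by (meson all_not_in_conv norm_ge_zero order_trans subsetD)

lemma U_norm_scale:
  assumes "f \<in> U_space D" shows "U_norm D (\<lambda>z. c * f z) = cmod c * U_norm D f"
proof (cases "c = 0")
  case True
  then show ?thesis
    using U_norm_scale_le[OF assms, of c] U_norm_nonneg[OF U.B_scale[OF assms, of c]] by simp
next
  case False
  have "U_norm D f \<le> cmod (1 / c) * U_norm D (\<lambda>z. c * f z)"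
    using U_norm_scale_le[OF U.B_scale[OF assms, of c], of "1 / c"] False by simp
  then have "cmod c * U_norm D f \<le> U_norm D (\<lambda>z. c * f z)"
    using False by (simp add: norm_divide field_simps)
  then show ?thesis using U_norm_scale_le[OF assms, of c] by simp
qed

lemma U_norm_pos:
  assumes "f \<in> U_space D" "f \<noteq> 0" shows "0 < U_norm D f"
proof -
  obtain z where "z \<in> D" "f z \<noteq> 0" using U.B_zero assms by blast
  then show ?thesis using U_norm_bound[OF assms(1), of z] closure_subset
    by (metis norm_le_zero_iff linorder_not_le order_trans subsetD)
qed

text \<open>By Cauchy's estimates the unit ball of \<open>U(D)\<close> is equicontinuous on \<open>K\<close>, and \<open>L f\<close> depends
  only on the values of \<open>f\<close> on \<open>K\<close>.\<close>

lemma transfer_operator_compact: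
  fixes y :: "nat \<Rightarrow> complex ^ 'd \<Rightarrow> complex"
  assumes y: "\<And>n. y n \<in> U_space D" "\<And>n. U_norm D (y n) \<le> 1" and "0 < \<epsilon>"
  shows "\<exists>m n. m < n \<and> U_norm D (U.L (y n) - U.L (y m)) < \<epsilon>"
proof -
  obtain R where R: "R > 0" "(\<Union>x\<in>K. ball x R) \<subseteq> D"
    using compact_subset_open_imp_ball_epsilon_subset[OF compact_K domain(1) K_subset] by blast
  define r where "r = R / 4"
  have r: "r > 0" using R by (simp add: r_def)
  have y1: "cmod (y n z) \<le> 1" if "z \<in> D" for n z
    using U_norm_bound[OF y(1), of z n] y(2)[of n] closure_subset that by force
  \<comment> \<open>A subsequence converging uniformly on \<open>K\<close>; two consecutive members
    far enough along it will be the required pair.\<close>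
  obtain g k where g: "strict_mono (k :: nat \<Rightarrow> nat)"
    "\<And>e. 0 < e \<Longrightarrow> \<exists>N. \<forall>n x. n \<ge> N \<and> x \<in> K \<longrightarrow> cmod (y (k n) x - g x) < e"
  proof (rule Arzela_Ascoli[OF compact_K, of y 1])
    show "cmod (y n x) \<le> 1" if "x \<in> K" for n x
      using y1 that K_subset by blast
    show "\<exists>d>0. \<forall>n x'. x' \<in> K \<and> norm (x - x') < d \<longrightarrow> cmod (y n x - y n x') < e"
      if x: "x \<in> K" and e: "0 < e" for x e
    proof (intro exI[of _ "min r (e * r)"] conjI allI impI)
      fix n x' assume x': "x' \<in> K \<and> norm (x - x') < min r (e * r)"
      have sub: "cball x (2 * r) \<subseteq> D" using R x by (force simp: r_def)
      have "cmod (y n x - y n x') \<le> 1 / r * norm (x - x')"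
        by (rule holomorphic_map_Lipschitz[OF U.B_hol[OF y(1)] sub r])
           (use y1 sub x' r in \<open>auto simp: dist_norm subset_iff\<close>)
      also have "\<dots> < e" using x' r by (simp add: field_simps)
      finally show "cmod (y n x - y n x') < e" .
    qed (use r e in simp)
  qed blast
  define W where "W = (\<Sum>\<^sub>\<infinity>i\<in>I. U_norm D (w i))"
  have W: "W \<ge> 0" unfolding W_def by (rule infsum_nonneg) (rule U_norm_w_nonneg)
  \<comment> \<open>Makes \<open>W * (2 * e) = \<epsilon> / 2 * (W / (W + 1))\<close>, which is
    below \<open>\<epsilon>\<close>; adding 1 avoids a zero denominator.\<close>
  define e where "e = \<epsilon> / (4 * (W + 1))"
  have e: "e > 0" using W assms(3) by (simp add: e_def)
  obtain N where N: "\<And>n x. n \<ge> N \<Longrightarrow> x \<in> K \<Longrightarrow> cmod (y (k n) x - g x) < e"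
    using g(2)[OF e] by blast
  define u where "u = y (k (Suc N)) - y (k N)"
  have u_small: "cmod (u x) \<le> 2 * e" if "x \<in> K" for x
    using N[of "Suc N" x] N[of N x] that norm_triangle_ineq4[of "y (k (Suc N)) x - g x" "y (k N) x - g x"]
    by (simp add: u_def)
  have "U_norm D (U.L u) \<le> W * (2 * e)"
  proof (rule U_norm_least[OF domain(4)])
    fix z assume z: "z \<in> closure D"
    then show "cmod (U.L u z) \<le> W * (2 * e)"
      using weighted_composition_summable(2)[OF summable_w, of w z u T "2 * e"] w_le T_in_K u_small
      by (simp add: transfer_operator_def restrict_zero_def W_def)
  qed
  also have "\<dots> = \<epsilon> / 2 * (W / (W + 1))" using W by (simp add: e_def field_simps)
  also have "\<dots> \<le> \<epsilon> / 2 * 1" using W assms(3) by (intro mult_left_mono) auto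
  also have "\<dots> < \<epsilon>" using assms(3) by simp
  finally have "U_norm D (U.L (y (k (Suc N))) - U.L (y (k N))) < \<epsilon>"
    unfolding u_def U.L_diff[OF y(1) y(1)] .
  then show ?thesis using g(1) by (metis lessI strict_mono_less)
qed

text \<open>Otherwise there is a strictly increasing sequence of invariant subspaces on whose successive
  quotients \<open>L\<close> acts by scalars of modulus at least \<open>r\<close>, and Riesz's lemma contradicts compactness.\<close>

lemma generalized_eigenspaces_finite:
  assumes r: "0 < r"
  shows "\<exists>F. finite F \<and> (\<forall>\<mu>. r \<le> cmod \<mu> \<longrightarrow> U.G \<mu> \<subseteq> cfun.span F)"
proof (rule ccontr)
  assume neg: "\<not> ?thesis"
  \<comment> \<open>\<open>good\<close> sets span finite-dimensional invariant subspaces;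
    \<open>extends\<close> supplies a new vector on which \<open>L\<close> acts as
    \<open>\<mu>\<close> modulo the span, so that adding it keeps invariance.\<close>
  define good where "good F \<longleftrightarrow> finite F \<and> F \<subseteq> U_space D \<and> (\<forall>f\<in>F. U.L f \<in> cfun.span F)" for F
  define extends where "extends F g \<mu> \<longleftrightarrow> r \<le> cmod \<mu> \<and> g \<in> U_space D \<and> g \<notin> cfun.span F
    \<and> U.L g - (\<lambda>z. \<mu> * g z) \<in> cfun.span F" for F g \<mu>
  have ex_extension: "\<exists>g \<mu>. extends F g \<mu>" if F: "good F" for F
  proof -
    obtain \<mu> f where \<mu>: "r \<le> cmod \<mu>" and f: "f \<in> U.G \<mu>" "f \<notin> cfun.span F"
      using neg F unfolding good_def by blast
    obtain k where k: "f \<in> U_space D" "(U.shift \<mu> ^^ k) f = 0" using f(1) by (rule U.GE)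
    \<comment> \<open>The last iterate of \<open>shift \<mu>\<close> that is still outside the span,
      at exponent \<open>j - 1\<close>, is the new vector.\<close>
    define j where "j = (LEAST k. (U.shift \<mu> ^^ k) f \<in> cfun.span F)"
    have "(U.shift \<mu> ^^ k) f \<in> cfun.span F" unfolding k(2) by (rule cfun.span_zero)
    then have j: "(U.shift \<mu> ^^ j) f \<in> cfun.span F" unfolding j_def by (rule LeastI)
    have "j \<noteq> 0"
    proof
      assume "j = 0"
      with j have "f \<in> cfun.span F" by (simp only: funpow_0)
      with f(2) show False ..
    qed
    then obtain i where i: "j = Suc i" using not0_implies_Suc by blast
    define g where "g = (U.shift \<mu> ^^ i) f"
    have "g \<notin> cfun.span F"
      unfolding g_def using not_less_Least[of i "\<lambda>k. (U.shift \<mu> ^^ k) f \<in> cfun.span F"] i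
      unfolding j_def by simp
    moreover have "U.L g - (\<lambda>z. \<mu> * g z) \<in> cfun.span F"
      unfolding g_def using j unfolding i by (simp only: funpow.simps o_apply)
    moreover have "g \<in> U_space D" unfolding g_def by (rule U.shift_power_in_B[OF k(1)])
    ultimately show ?thesis using \<mu> unfolding extends_def by blast
  qed
  have good_insert: "good (insert g F)" if F: "good F" and g: "extends F g \<mu>" for F g \<mu>
  proof -
    have mono: "cfun.span F \<subseteq> cfun.span (insert g F)" by (rule cfun.span_mono) auto
    have "U.L g - (\<lambda>z. \<mu> * g z) \<in> cfun.span (insert g F)"
      using g mono unfolding extends_def by blast
    then have "(U.L g - (\<lambda>z. \<mu> * g z)) + (\<lambda>z. \<mu> * g z) \<in> cfun.span (insert g F)"
      by (intro cfun.span_add cfun.span_scale[of g] cfun.span_base[of g] insertI1)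
    then have "U.L g \<in> cfun.span (insert g F)" by (simp only: diff_add_cancel)
    then show ?thesis using F g mono unfolding good_def extends_def by auto
  qed
  have "\<exists>x. \<forall>n. (good (fst (x n)) \<and> extends (fst (x n)) (fst (snd (x n))) (snd (snd (x n))))
      \<and> fst (x (Suc n)) = insert (fst (snd (x n))) (fst (x n))"
  proof (rule dependent_nat_choice)
    have "good {}" by (simp add: good_def)
    then show "\<exists>x. good (fst x) \<and> extends (fst x) (fst (snd x)) (snd (snd x))"
      using ex_extension[of "{}"] by force
  next
    fix x :: "(complex ^ 'd \<Rightarrow> complex) set \<times> (complex ^ 'd \<Rightarrow> complex) \<times> complex"
    assume "good (fst x) \<and> extends (fst x) (fst (snd x)) (snd (snd x))"
    then have "good (insert (fst (snd x)) (fst x))" using good_insert by blast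
    then show "\<exists>y. (good (fst y) \<and> extends (fst y) (fst (snd y)) (snd (snd y)))
        \<and> fst y = insert (fst (snd x)) (fst x)"
      using ex_extension[of "insert (fst (snd x)) (fst x)"] by force
  qed
  then obtain x where x: "\<And>n. good (fst (x n))" "\<And>n. extends (fst (x n)) (fst (snd (x n))) (snd (snd (x n)))"
    "\<And>n. fst (x (Suc n)) = insert (fst (snd (x n))) (fst (x n))" by blast
  define F where "F n = fst (x n)" for n
  define g where "g n = fst (snd (x n))" for n
  define \<mu> where "\<mu> n = snd (snd (x n))" for n
  have F: "good (F n)" "F (Suc n) = insert (g n) (F n)" and extends: "extends (F n) (g n) (\<mu> n)" for n
    using x by (simp_all add: F_def g_def \<mu>_def)
  have F': "finite (F n)" "F n \<subseteq> U_space D" "\<And>f. f \<in> F n \<Longrightarrow> U.L f \<in> cfun.span (F n)" for n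
    using F(1) unfolding good_def by auto
  have g: "r \<le> cmod (\<mu> n)" "g n \<in> U_space D" "g n \<notin> cfun.span (F n)"
      "U.L (g n) - (\<lambda>z. \<mu> n * g n z) \<in> cfun.span (F n)" for n
    using extends unfolding extends_def by auto
  have "\<exists>y c. y \<in> U_space D \<and> U_norm D y = 1 \<and> y - (\<lambda>z. c * g n z) \<in> cfun.span (F n)
      \<and> (\<forall>u\<in>cfun.span (F n). 1 / 2 \<le> U_norm D (y - u))" for n
    by (rule Riesz_lemma_span[OF subspace_U_space U_norm_add U_norm_scale U_norm_pos F'(1,2) g(2,3)]) blast+
  then obtain y c where y: "\<And>n. y n \<in> U_space D" "\<And>n. U_norm D (y n) = 1"
    "\<And>n. y n - (\<lambda>z. c n * g n z) \<in> cfun.span (F n)"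
    "\<And>n u. u \<in> cfun.span (F n) \<Longrightarrow> 1 / 2 \<le> U_norm D (y n - u)"
    by metis
  have inv: "U.L f \<in> cfun.span (F n)" if "f \<in> cfun.span (F n)" for f n
    using U.L_span_invariant[OF F'(2) F'(3) that] .
  have mono: "F m \<subseteq> F n" if "m \<le> n" for m n
    using that by (rule lift_Suc_mono_le[rotated]) (auto simp: F(2))
  have y_next: "y m \<in> cfun.span (F (Suc m))" for m
    unfolding F(2) cfun.span_breakdown_eq using y(3) by blast
  \<comment> \<open>The Riesz vectors inherit the scalar action from \<open>g n\<close>, as they
    differ from a multiple of it by an element of the invariant span.\<close>
  have Ly: "U.L (y n) - (\<lambda>z. \<mu> n * y n z) \<in> cfun.span (F n)" for n
  proof -
    define v where "v = y n - (\<lambda>z. c n * g n z)"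
    have v: "v \<in> cfun.span (F n)" unfolding v_def by (rule y(3))
    have "v \<in> U_space D" using v F'(2) cfun.span_minimal[OF _ subspace_U_space] by blast
    have yv: "y n = v + (\<lambda>z. c n * g n z)" unfolding v_def by (simp only: diff_add_cancel)
    have L: "U.L (y n) = U.L v + (\<lambda>z. c n * U.L (g n) z)"
      unfolding yv U.L_add[OF \<open>v \<in> U_space D\<close> U.B_scale[OF g(2)]] U.L_scale ..
    define s where "s = U.L (g n) - (\<lambda>z. \<mu> n * g n z)"
    have Lz: "U.L (y n) z = U.L v z + c n * U.L (g n) z" for z unfolding L by simp
    have yz: "y n z = v z + c n * g n z" for z unfolding yv by simp
    have sz: "s z = U.L (g n) z - \<mu> n * g n z" for z by (simp add: s_def)
    have "U.L (y n) - (\<lambda>z. \<mu> n * y n z) = (U.L v - (\<lambda>z. \<mu> n * v z)) + (\<lambda>z. c n * s z)"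
      by (rule ext) (simp add: Lz yz sz algebra_simps)
    also have "\<dots> \<in> cfun.span (F n)"
      using g(4)[of n] unfolding s_def[symmetric]
      by (intro cfun.span_add cfun.span_diff cfun.span_scale inv v)
    finally show ?thesis .
  qed
  \<comment> \<open>Apart from \<open>\<mu> n\<close> times \<open>y n\<close>, every part of the
    difference lies in the span of \<open>F n\<close>. Factoring out \<open>\<mu> n\<close> leaves
    \<open>y n\<close> minus an element of that span, which has norm at least
    \<open>1 / 2\<close>.\<close>
  have "r / 2 \<le> U_norm D (U.L (y n) - U.L (y m))" if mn: "m < n" for m n
  proof -
    have "cfun.span (F (Suc m)) \<subseteq> cfun.span (F n)" using mono[of "Suc m" n] mn by (intro cfun.span_mono) auto
    then have "U.L (y m) \<in> cfun.span (F n)" using inv y_next by blast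
    define t where "t = U.L (y m) - (U.L (y n) - (\<lambda>z. \<mu> n * y n z))"
    have t: "t \<in> cfun.span (F n)" unfolding t_def by (rule cfun.span_diff[OF \<open>U.L (y m) \<in> cfun.span (F n)\<close> Ly])
    have \<mu>n: "\<mu> n \<noteq> 0" using g(1)[of n] r by auto
    define t' where "t' = (\<lambda>z. (1 / \<mu> n) * t z)"
    have t': "t' \<in> cfun.span (F n)" unfolding t'_def by (rule cfun.span_scale[OF t])
    have "y n - t' \<in> U_space D"
      using y(1) t' F'(2) cfun.span_minimal[OF _ subspace_U_space] U.B_diff by blast
    from U_norm_scale[OF this, of "\<mu> n"]
    have "U_norm D (\<lambda>z. \<mu> n * (y n - t') z) = cmod (\<mu> n) * U_norm D (y n - t')" .
    moreover have "(\<lambda>z. \<mu> n * (y n - t') z) = U.L (y n) - U.L (y m)"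
      unfolding t'_def t_def by (rule ext) (use \<mu>n in \<open>simp add: field_simps\<close>)
    ultimately have "U_norm D (U.L (y n) - U.L (y m)) = cmod (\<mu> n) * U_norm D (y n - t')" by simp
    also have "\<dots> \<ge> r * (1 / 2)" using g(1)[of n] y(4)[OF t'] r by (intro mult_mono) auto
    finally show ?thesis by simp
  qed
  then show False
    using transfer_operator_compact[of y "r / 2"] y(1,2) r by (metis half_gt_zero linorder_not_le order_refl)
qed

end

section \<open>Arranging eigenvalues in a sequence\<close>

text \<open>Each nonzero \<open>\<mu>\<close> is split into \<open>m \<mu>\<close> copies. Ordered
  by decreasing modulus, every copy has finitely many predecessors, because the moduli can
  accumulate only at 0; counting them gives its position.\<close>

lemma ex_sequence_with_multiplicities:
  fixes m :: "complex \<Rightarrow> nat"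
  assumes fin: "\<And>r. 0 < r \<Longrightarrow> finite {\<mu>. r \<le> cmod \<mu> \<and> m \<mu> \<noteq> 0}"
  shows "\<exists>s. decseq (\<lambda>n. cmod (s n)) \<and> (\<forall>\<mu>. \<mu> \<noteq> 0 \<longrightarrow> finite {n. s n = \<mu>} \<and> card {n. s n = \<mu>} = m \<mu>)"
proof -
  define P where "P = {(\<mu>, j). \<mu> \<noteq> 0 \<and> j < m \<mu>}"
  have fin_P: "finite {p \<in> P. r \<le> cmod (fst p)}" if "r > 0" for r
  proof -
    have "{p \<in> P. r \<le> cmod (fst p)} \<subseteq> Sigma {\<mu>. r \<le> cmod \<mu> \<and> m \<mu> \<noteq> 0} (\<lambda>\<mu>. {..<m \<mu>})"
      by (auto simp: P_def)
    then show ?thesis by (rule finite_subset) (intro finite_SigmaI fin[OF that] finite_lessThan)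
  qed
  have "P \<subseteq> (\<Union>n. {p \<in> P. 1 / real (Suc n) \<le> cmod (fst p)})"
  proof
    fix p assume p: "p \<in> P"
    then have "cmod (fst p) > 0" by (auto simp: P_def)
    then obtain n where "1 / real (Suc n) < cmod (fst p)" using nat_approx_posE by blast
    then show "p \<in> (\<Union>n. {p \<in> P. 1 / real (Suc n) \<le> cmod (fst p)})" using p by (auto intro: less_imp_le)
  qed
  moreover have "countable (\<Union>n. {p \<in> P. 1 / real (Suc n) \<le> cmod (fst p)})"
    using fin_P by (intro countable_UN countableI_type countable_finite) simp
  ultimately have "countable P" by (rule countable_subset)
  then obtain t :: "complex \<times> nat \<Rightarrow> nat" where t: "inj_on t P" by (rule countableE)
  \<comment> \<open>Ties in modulus are broken by the injection \<open>t\<close> into the naturals,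
    which makes the order total on \<open>P\<close>.\<close>
  define prec where "prec q p \<longleftrightarrow> cmod (fst p) < cmod (fst q) \<or> cmod (fst p) = cmod (fst q) \<and> t q < t p" for q p
  define rank where "rank p = card {q \<in> P. prec q p}" for p
  have fin_prec: "finite {q \<in> P. prec q p}" if "p \<in> P" for p
    by (rule finite_subset[OF _ fin_P[of "cmod (fst p)"]]) (use that in \<open>auto simp: prec_def P_def\<close>)
  have rank_less: "rank q < rank p" if "p \<in> P" "q \<in> P" "prec q p" for p q
    unfolding rank_def
  proof (rule psubset_card_mono[OF fin_prec[OF that(1)]])
    have "{a \<in> P. prec a q} \<subseteq> {a \<in> P. prec a p}" using that(3) by (auto simp: prec_def)
    moreover have "q \<in> {a \<in> P. prec a p}" "q \<notin> {a \<in> P. prec a q}" using that by (auto simp: prec_def)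
    ultimately show "{a \<in> P. prec a q} \<subset> {a \<in> P. prec a p}" by blast
  qed
  have total: "prec p q \<or> prec q p" if "p \<in> P" "q \<in> P" "p \<noteq> q" for p q
  proof -
    have "t p \<noteq> t q" using t that by (auto dest: inj_onD)
    then show ?thesis unfolding prec_def by linarith
  qed
  have inj: "inj_on rank P"
  proof (rule inj_onI, rule ccontr)
    fix p q assume "p \<in> P" "q \<in> P" "rank p = rank q" "p \<noteq> q"
    then show False using total[of p q] rank_less[of p q] rank_less[of q p] by auto
  qed
  \<comment> \<open>Positions have no gaps: the predecessors of \<open>p\<close> have distinct ranks
    below \<open>rank p\<close>, and there are exactly \<open>rank p\<close> of them.\<close>
  have down: "n \<in> rank ` P" if p: "p \<in> P" and n: "n < rank p" for n p
  proof -
    have "rank ` {q \<in> P. prec q p} = {..<rank p}"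
    proof (rule card_subset_eq)
      show "rank ` {q \<in> P. prec q p} \<subseteq> {..<rank p}" using rank_less[OF p] by auto
      show "card (rank ` {q \<in> P. prec q p}) = card {..<rank p}"
        using card_image[OF inj_on_subset[OF inj]] by (simp add: rank_def)
    qed simp
    then show ?thesis using n by blast
  qed
  \<comment> \<open>The value 0 pads the sequence when \<open>P\<close> is finite.\<close>
  define s where "s n = (if n \<in> rank ` P then fst (inv_into P rank n) else 0)" for n
  have s_rank: "s (rank p) = fst p" if "p \<in> P" for p
    using that inj by (simp add: s_def)
  have "decseq (\<lambda>n. cmod (s n))"
    unfolding decseq_def
  proof (intro allI impI)
    fix i n :: nat assume "i \<le> n"
    show "cmod (s n) \<le> cmod (s i)"
    proof (cases "n \<in> rank ` P")
      case True
      then obtain p where p: "p \<in> P" "n = rank p" by blast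
      then obtain q where q: "q \<in> P" "i = rank q" using down[OF p(1), of i] \<open>i \<le> n\<close>
        by (cases "i = rank p") auto
      have "\<not> prec p q" using rank_less[OF q(1) p(1)] \<open>i \<le> n\<close> p q by auto
      then have "cmod (fst p) \<le> cmod (fst q)" by (auto simp: prec_def)
      then show ?thesis using p q s_rank by simp
    qed (simp add: s_def)
  qed
  moreover have "finite {n. s n = \<mu>} \<and> card {n. s n = \<mu>} = m \<mu>" if \<mu>: "\<mu> \<noteq> 0" for \<mu>
  proof -
    have eq: "{n. s n = \<mu>} = rank ` (Pair \<mu> ` {..<m \<mu>})"
    proof
      show "{n. s n = \<mu>} \<subseteq> rank ` (Pair \<mu> ` {..<m \<mu>})"
      proof
        fix n assume "n \<in> {n. s n = \<mu>}"
        then have "n \<in> rank ` P" "s n = \<mu>" using \<mu> by (auto simp: s_def split: if_splits)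
        then obtain p where p: "p \<in> P" "n = rank p" "fst p = \<mu>" using s_rank by auto
        then have "p \<in> Pair \<mu> ` {..<m \<mu>}" by (auto simp: P_def)
        then show "n \<in> rank ` (Pair \<mu> ` {..<m \<mu>})" using p by blast
      qed
      show "rank ` (Pair \<mu> ` {..<m \<mu>}) \<subseteq> {n. s n = \<mu>}"
        using s_rank \<mu> by (auto simp: P_def)
    qed
    have "Pair \<mu> ` {..<m \<mu>} \<subseteq> P" using \<mu> by (auto simp: P_def)
    then have "card {n. s n = \<mu>} = m \<mu>"
      unfolding eq using card_image[OF inj_on_subset[OF inj]] by (metis card_image card_lessThan inj_on_def Pair_inject)
    then show ?thesis unfolding eq by simp
  qed
  ultimately show ?thesis by blast
qed

context map_weight_system
begin

interpretation U: transfer_space X D I T w "closure D" "U_space D"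
  by (rule transfer_space_U)

text \<open>Ensures that the equality of eigenvalue sequences is not one between empty sets. Finite
  multiplicities and the finite number of eigenvalues of modulus at least \<open>r\<close> both come
  from the single span that contains all \<open>U.G \<mu>\<close> with
  \<open>r \<le> cmod \<mu>\<close>.\<close>

lemma eigenvalue_sequences_U_nonempty: "eigenvalue_sequences (U_space D) U.L \<noteq> {}"
proof -
  have mult: "algebraic_multiplicity (U_space D) U.L \<mu> = enat (cfun.dim (U.G \<mu>))" if "\<mu> \<noteq> 0" for \<mu>
    using generalized_eigenspaces_finite[of "cmod \<mu>"] that
    unfolding algebraic_multiplicity_def by auto
  have "finite {\<mu>. r \<le> cmod \<mu> \<and> cfun.dim (U.G \<mu>) \<noteq> 0}" if r: "0 < r" for r
  proof -
    obtain F where F: "finite F" "\<And>\<mu>. r \<le> cmod \<mu> \<Longrightarrow> U.G \<mu> \<subseteq> cfun.span F"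
      using generalized_eigenspaces_finite[OF r] by blast
    have "cfun.dim {0 :: complex ^ 'd \<Rightarrow> complex} = 0"
      using cfun.dim_eq_card[of "{}" "{0 :: complex ^ 'd \<Rightarrow> complex}"] by (simp add: cfun.independent_empty)
    then show ?thesis
      using F by (intro U.finite_eigenvalues[of F]) auto
  qed
  from ex_sequence_with_multiplicities[OF this] show ?thesis
    unfolding eigenvalue_sequences_def using mult by fastforce
qed

end

section \<open>Favourable spaces and the final comparison\<close>

lemma transfer_space_favourable:
  assumes sys: "map_weight_system X D I T w" and A: "favourable_space D A N"
  shows "transfer_space X D I T w D A"
proof -
  interpret map_weight_system X D I T w by fact
  show ?thesis
  proof unfold_locales
    show "D \<subseteq> closure D" by (rule closure_subset)
    show "cfun.subspace A" using A by (simp add: favourable_space_def banach_function_space_def)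
    show "holomorphic_map (*) f D" if "f \<in> A" for f using that A by (simp add: favourable_space_def)
    show "f = 0" if "f \<in> A" "\<And>z. z \<in> D \<Longrightarrow> f z = 0" for f
    proof
      show "f z = 0 z" for z using that A by (cases "z \<in> D") (auto simp: favourable_space_def)
    qed
    show "restrict_zero D f \<in> A" if "in_U (*) D f" for f
    proof -
      have "restrict_zero (closure D) f \<in> U_space D"
        using restrict_zero_in_U[OF that domain(1)] by (simp add: U_space_iff restrict_zero_def)
      moreover have "restrict_zero D f = restrict_zero D (restrict_zero (closure D) f)"
        using closure_subset by (fastforce simp: restrict_zero_def)
      ultimately show ?thesis using A unfolding favourable_space_def by blast
    qed
  qed simp
qed

lemma admissible_map_weight_system:
  assumes "compact X" "X \<noteq> {}" "analytic_map_weight_system X I T w" "admissible_with X I T w D T\<^sub>D w\<^sub>D"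
  shows "map_weight_system X D I T\<^sub>D w\<^sub>D"
proof unfold_locales
  have D: "map_extension X I T D T\<^sub>D" "weight_extension X I w D w\<^sub>D"
    using assms(4) by (auto simp: admissible_with_def)
  show "bounded_domain D" "holomorphic_map_system D I T\<^sub>D" "holomorphic_weight_system D I w\<^sub>D"
    using D by (auto simp: map_extension_def weight_extension_def)
  show "X \<subseteq> D"
    using D closure_subset by (fastforce simp: map_extension_def compactly_inside_def)
  show "T\<^sub>D i x \<in> X" if "i \<in> I" "x \<in> X" for i x
  proof -
    have "T i ` X \<subseteq> X"
      using assms(3) that by (simp add: analytic_map_weight_system_def analytic_map_system_def)
    moreover have "T\<^sub>D i x = T i x"
      using D(1) that unfolding map_extension_def agree_near_def by blast
    ultimately show ?thesis using that by auto
  qed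
qed (use assms in auto)

lemma agree_near_trans:
  assumes "agree_near X f g" "agree_near X h g" shows "agree_near X f h"
proof -
  obtain M N where "open M" "X \<subseteq> M" "\<forall>z\<in>M. f z = g z" "open N" "X \<subseteq> N" "\<forall>z\<in>N. h z = g z"
    using assms unfolding agree_near_def by blast
  then show ?thesis unfolding agree_near_def by (intro exI[of _ "M \<inter> N"]) auto
qed

theorem corollary4p3:
  fixes X :: "(complex ^ 'd) set"
    and I :: "'i set"
    and T :: "'i \<Rightarrow> complex ^ 'd \<Rightarrow> complex ^ 'd"
    and w :: "'i \<Rightarrow> complex ^ 'd \<Rightarrow> complex"
    and D :: "(complex ^ 'd) set"
    and T\<^sub>D :: "'i \<Rightarrow> complex ^ 'd \<Rightarrow> complex ^ 'd"
    and w\<^sub>D :: "'i \<Rightarrow> complex ^ 'd \<Rightarrow> complex"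
    and A :: "(complex ^ 'd \<Rightarrow> complex) set"
    and N :: "(complex ^ 'd \<Rightarrow> complex) \<Rightarrow> real"
  assumes "compact X" and "X \<noteq> {}"
    and "countable I" and "I \<noteq> {}"
    and "analytic_map_weight_system X I T w"
    and "complex_contracting X I T"
    and "admissible_with X I T w D T\<^sub>D w\<^sub>D"
    and "favourable_space D A N"
  shows "transfer_operator D I T\<^sub>D w\<^sub>D ` A \<subseteq> A \<and>
    eigenvalue_sequences A (transfer_operator D I T\<^sub>D w\<^sub>D) \<noteq> {} \<and>
    (\<forall>D\<^sub>0 T\<^sub>0 w\<^sub>0. admissible_with X I T w D\<^sub>0 T\<^sub>0 w\<^sub>0 \<longrightarrow>
      eigenvalue_sequences A (transfer_operator D I T\<^sub>D w\<^sub>D) =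
      eigenvalue_sequences (U_space D\<^sub>0) (transfer_operator (closure D\<^sub>0) I T\<^sub>0 w\<^sub>0))"
proof -
  note system = admissible_map_weight_system[OF assms(1,2,5)]
  interpret A: transfer_space X D I T\<^sub>D w\<^sub>D D A
    by (rule transfer_space_favourable[OF system[OF assms(7)] assms(8)])
  have eq: "eigenvalue_sequences A A.L =
      eigenvalue_sequences (U_space D\<^sub>0) (transfer_operator (closure D\<^sub>0) I T\<^sub>0 w\<^sub>0)"
    if adm: "admissible_with X I T w D\<^sub>0 T\<^sub>0 w\<^sub>0" for D\<^sub>0 T\<^sub>0 w\<^sub>0
  proof -
    interpret U: transfer_space X D\<^sub>0 I T\<^sub>0 w\<^sub>0 "closure D\<^sub>0" "U_space D\<^sub>0"
      by (rule map_weight_system.transfer_space_U[OF system[OF adm]])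
    interpret transfer_space_pair X D D\<^sub>0 I T\<^sub>D T\<^sub>0 w\<^sub>D w\<^sub>0 D "closure D\<^sub>0" A "U_space D\<^sub>0"
      by unfold_locales
        (use adm assms(7) in \<open>auto simp: admissible_with_def map_extension_def weight_extension_def
          intro: agree_near_trans\<close>)
    show ?thesis by (rule eigenvalue_sequences_eq)
  qed
  \<comment> \<open>Taking \<open>D\<close> itself as the second domain reduces existence on
    \<open>A\<close> to existence on \<open>U(D)\<close>, where compactness is available.\<close>
  moreover have "eigenvalue_sequences A A.L \<noteq> {}"
    unfolding eq[OF assms(7)]
    by (rule map_weight_system.eigenvalue_sequences_U_nonempty[OF system[OF assms(7)]])
  ultimately show ?thesis using A.L_in_B by blast
qed

end
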